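(* Let $L/K$ be a totally ramified extension of degree $n=up^\nu$ with $p\nmid u$. Let $r\in\mathbb{Z}$, let $1\le h\le n$, and set $j=\min\{v_p(h),\nu\}$. Then $E_h(\mathcal{M}_L^r)\subset\mathcal{M}_K^{\lceil(i_j+hr)/n\rceil}$; equivalently $g_h(r)\ge\lceil(i_j+hr)/n\rceil$.
   Context: $K$ is a field complete with respect to a discrete valuation $v_K$ whose residue field is perfect of characteristic $p$; $K^{sep}$ is a separable closure and $L\subset K^{sep}$ is a finite (separable) totally ramified extension. $\mathcal{M}_K,\mathcal{M}_L$ are the maximal ideals; $v_L$ is normalized with $v_L=nv_K$ on $K$; $e_L=v_L(p)$ ($=\infty$ if $\mathrm{char}\,K=p$). $\sigma_1,\dots,\sigma_n$ are the $K$-embeddings $L\to K^{sep}$, and $E_h(\alpha)=e_h(\sigma_1(\alpha),\dots,\sigma_n(\alpha))$ where $e_h$ is the $h$th elementary symmetric polynomial; $g_h(r)=\min\{v_K(E_h(\alpha)):\alpha\in\mathcal{M}_L^r\}$. Indices of inseparability: let $\pi_L$ be a uniformizer of $L$ with minimal polynomial $X^n-c_1X^{n-1}+\dots+(-1)^nc_n$ over $K$; with $\overline{v}_p(k)=\min\{v_p(k),\nu\}$, set $i_j^{\pi_L}=\min\{nv_K(c_h)-h:1\le h\le n,\ \overline{v}_p(h)\le j\}$ and $i_j=\min\{i_{j'}^{\pi_L}+(j'-j)e_L:j\le j'\le\nu\}$ for $0\le j\le\nu$ (this is independent of the choice of $\pi_L$). *)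

theory Defs
  imports
    "Jordan_Normal_Form.Ring_Hom_Matrix"
    "HOL-Algebra.QuotRing"
    "HOL-Library.Extended_Real"
    "HOL-Computational_Algebra.Computational_Algebra"
begin

text \<open>
  The fields \<open>K\<close>, \<open>L\<close>, \<open>K\<^sup>s\<^sup>e\<^sup>p\<close> are the types \<open>'k\<close>, \<open>'l\<close>, \<open>'s\<close>; the inclusions
  \<open>K \<subseteq> L \<subseteq> K\<^sup>s\<^sup>e\<^sup>p\<close> are field homomorphisms \<open>\<iota> :: 'k \<Rightarrow> 'l\<close> and \<open>\<tau> :: 'l \<Rightarrow> 's\<close>.
  Valuations take values in the extended reals, with \<open>v 0 = \<infinity>\<close>.
\<close>

text \<open>Discrete valuations are normalized: their value group is \<open>\<int>\<close>.\<close>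

definition discrete_valuation :: "('k::field \<Rightarrow> ereal) \<Rightarrow> bool" where
  "discrete_valuation v \<longleftrightarrow>
     (\<forall>x. v x = \<infinity> \<longleftrightarrow> x = 0) \<and>
     v ` (UNIV - {0}) = range (\<lambda>m::int. ereal (of_int m)) \<and>
     (\<forall>x y. v (x * y) = v x + v y) \<and>
     (\<forall>x y. min (v x) (v y) \<le> v (x + y))"

definition valuation_complete :: "('k::field \<Rightarrow> ereal) \<Rightarrow> bool" where
  "valuation_complete v \<longleftrightarrow>
     (\<forall>X :: nat \<Rightarrow> 'k.
        (\<forall>N::int. \<exists>M. \<forall>i\<ge>M. \<forall>j\<ge>M. ereal (of_int N) \<le> v (X i - X j)) \<longrightarrow>
        (\<exists>x. \<forall>N::int. \<exists>M. \<forall>i\<ge>M. ereal (of_int N) \<le> v (X i - x)))"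

definition valuation_ring :: "('k::field \<Rightarrow> ereal) \<Rightarrow> 'k ring" where
  "valuation_ring v = \<lparr>carrier = {x. 0 \<le> v x}, mult = (*), one = 1, zero = 0, add = (+)\<rparr>"

definition maximal_ideal :: "('k::field \<Rightarrow> ereal) \<Rightarrow> 'k set" where
  "maximal_ideal v = {x. 0 < v x}"

definition maximal_ideal_power :: "('k::field \<Rightarrow> ereal) \<Rightarrow> int \<Rightarrow> 'k set" where
  "maximal_ideal_power v r = {x. ereal (of_int r) \<le> v x}"

definition residue_field :: "('k::field \<Rightarrow> ereal) \<Rightarrow> 'k set ring" where
  "residue_field v = valuation_ring v Quot maximal_ideal v"

definition perfect_field_of_char :: "nat \<Rightarrow> ('a, 'b) ring_scheme \<Rightarrow> bool" where
  "perfect_field_of_char p R \<longleftrightarrow>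
     Ring.field R \<and> prime p \<and> add_pow R p \<one>\<^bsub>R\<^esub> = \<zero>\<^bsub>R\<^esub> \<and>
     (\<lambda>x. x [^]\<^bsub>R\<^esub> p) ` carrier R = carrier R"

text \<open>The degree is \<open>0\<close> when the extension is infinite.\<close>

definition ext_degree :: "('k::field \<Rightarrow> 'l::field) \<Rightarrow> nat" where
  "ext_degree \<iota> = vector_space.dim (\<lambda>c x. \<iota> c * x) UNIV"

text \<open>
  For normalized valuations the ramification index is the \<open>e\<close> with \<open>v\<^sub>L = e v\<^sub>K\<close> on \<open>K\<close>.
\<close>

definition totally_ramified ::
  "('k::field \<Rightarrow> ereal) \<Rightarrow> ('l::field \<Rightarrow> ereal) \<Rightarrow> ('k \<Rightarrow> 'l) \<Rightarrow> bool" where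
  "totally_ramified vK vL \<iota> \<longleftrightarrow> (\<forall>x. vL (\<iota> x) = ereal (real (ext_degree \<iota>)) * vK x)"

definition min_poly :: "('k::field \<Rightarrow> 'l::field) \<Rightarrow> 'l \<Rightarrow> 'k poly" where
  "min_poly \<iota> x = (THE f. lead_coeff f = 1 \<and> poly (map_poly \<iota> f) x = 0 \<and>
     (\<forall>g. g \<noteq> 0 \<and> poly (map_poly \<iota> g) x = 0 \<longrightarrow> degree f \<le> degree g))"

definition separable_poly :: "'k::field poly \<Rightarrow> bool" where
  "separable_poly f \<longleftrightarrow> coprime f (pderiv f)"

definition separable_element :: "('k::field \<Rightarrow> 's::field) \<Rightarrow> 's \<Rightarrow> bool" where
  "separable_element j x \<longleftrightarrow>
     (\<exists>f. f \<noteq> 0 \<and> poly (map_poly j f) x = 0) \<and> separable_poly (min_poly j x)"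

definition separable_closure :: "('k::field \<Rightarrow> 's::field) \<Rightarrow> bool" where
  "separable_closure j \<longleftrightarrow>
     field_hom j \<and> (\<forall>x. separable_element j x) \<and>
     (\<forall>f :: 's poly. separable_poly f \<and> 0 < degree f \<longrightarrow> (\<exists>x. poly f x = 0))"

definition embeddings :: "('k::field \<Rightarrow> 'l::field) \<Rightarrow> ('l \<Rightarrow> 's::field) \<Rightarrow> ('l \<Rightarrow> 's) set" where
  "embeddings \<iota> \<tau> = {\<sigma>. field_hom \<sigma> \<and> \<sigma> \<circ> \<iota> = \<tau> \<circ> \<iota>}"

definition elem_sym :: "nat \<Rightarrow> 'i set \<Rightarrow> ('i \<Rightarrow> 'a::comm_semiring_1) \<Rightarrow> 'a" where
  "elem_sym h I x = (\<Sum>S | S \<subseteq> I \<and> card S = h. \<Prod>i\<in>S. x i)"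

definition E_map :: "('k::field \<Rightarrow> 'l::field) \<Rightarrow> ('l \<Rightarrow> 's::field) \<Rightarrow> nat \<Rightarrow> 'l \<Rightarrow> 's" where
  "E_map \<iota> \<tau> h \<alpha> = elem_sym h (embeddings \<iota> \<tau>) (\<lambda>\<sigma>. \<sigma> \<alpha>)"

text \<open>
  The values of \<open>E_map\<close> lie in the copy of \<open>K\<close> inside \<open>K\<^sup>s\<^sup>e\<^sup>p\<close>, hence the inverse of
  the inclusion before applying \<open>v\<^sub>K\<close>. The values lie in \<open>\<int> \<union> {\<infinity>}\<close>, so the
  infimum is a minimum as soon as it is not \<open>-\<infinity>\<close>.
\<close>

definition g_fun ::
  "('k::field \<Rightarrow> ereal) \<Rightarrow> ('l::field \<Rightarrow> ereal) \<Rightarrow> ('k \<Rightarrow> 'l) \<Rightarrow> ('l \<Rightarrow> 's::field) \<Rightarrow> nat \<Rightarrow> int \<Rightarrow> ereal" where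
  "g_fun vK vL \<iota> \<tau> h r =
     (INF \<alpha>\<in>maximal_ideal_power vL r. vK (the_inv (\<tau> \<circ> \<iota>) (E_map \<iota> \<tau> h \<alpha>)))"

text \<open>\<open>min_poly \<iota> \<pi> = X\<^sup>n - c\<^sub>1 X\<^sup>n\<^sup>-\<^sup>1 + \<dots> + (-1)\<^sup>n c\<^sub>n\<close>, where \<open>c\<^sub>h = min_poly_coeff \<iota> \<pi> h\<close>.\<close>

definition min_poly_coeff :: "('k::field \<Rightarrow> 'l::field) \<Rightarrow> 'l \<Rightarrow> nat \<Rightarrow> 'k" where
  "min_poly_coeff \<iota> \<pi> h = (-1) ^ h * coeff (min_poly \<iota> \<pi>) (ext_degree \<iota> - h)"

definition trunc_val :: "nat \<Rightarrow> nat \<Rightarrow> nat \<Rightarrow> nat" where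
  "trunc_val p \<nu> k = min (multiplicity p k) \<nu>"

definition insep_index_unif ::
  "('k::field \<Rightarrow> ereal) \<Rightarrow> ('k \<Rightarrow> 'l::field) \<Rightarrow> nat \<Rightarrow> nat \<Rightarrow> 'l \<Rightarrow> nat \<Rightarrow> ereal" where
  "insep_index_unif vK \<iota> p \<nu> \<pi> j =
     Min ((\<lambda>h. ereal (real (ext_degree \<iota>)) * vK (min_poly_coeff \<iota> \<pi> h) - ereal (real h)) `
            {h \<in> {1..ext_degree \<iota>}. trunc_val p \<nu> h \<le> j})"

text \<open>
  Here \<open>e\<^sub>L = v\<^sub>L(p)\<close>, which is \<open>\<infinity>\<close> in characteristic \<open>p\<close>; note \<open>0 * \<infinity> = 0\<close> in
  \<^typ>\<open>ereal\<close>, so the term \<open>j' = j\<close> is \<open>insep_index_unif vK \<iota> p \<nu> \<pi> j\<close> in all characteristics.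
  Single terms may be \<open>\<infinity>\<close>, but for a finite separable totally ramified extension of degree
  \<open>u p\<^sup>\<nu>\<close> with \<open>p\<close> not dividing \<open>u\<close> the minimum is an integer when \<open>j \<le> \<nu>\<close>: in characteristic \<open>0\<close>
  both \<open>e\<^sub>L\<close> and \<open>c\<^sub>n\<close> contribute finite values, and in characteristic \<open>p\<close> separability gives
  some \<open>c\<^sub>h \<noteq> 0\<close> of truncated valuation \<open>0\<close>.
\<close>

definition insep_index ::
  "('k::field \<Rightarrow> ereal) \<Rightarrow> ('l::field \<Rightarrow> ereal) \<Rightarrow> ('k \<Rightarrow> 'l) \<Rightarrow> nat \<Rightarrow> nat \<Rightarrow> 'l \<Rightarrow> nat \<Rightarrow> ereal" where
  "insep_index vK vL \<iota> p \<nu> \<pi> j =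
     Min ((\<lambda>j'. insep_index_unif vK \<iota> p \<nu> \<pi> j' + ereal (real (j' - j)) * vL (of_nat p)) ` {j..\<nu>})"

end

theory Submission
  imports
    Defs
    "Jordan_Normal_Form.Char_Poly"
    "HOL-Library.Poly_Mapping"
begin

text \<open>
  Expand \<open>\<alpha> = \<Sum> b\<^sub>i \<pi>\<^sup>i\<close> with \<open>i < n\<close>. Then \<open>E\<^sub>h(\<alpha>)\<close> is, up to sign, a coefficient of the characteristic
  polynomial of \<open>M = \<Sum> b\<^sub>i C\<^sup>i\<close>, where \<open>C\<close> is the companion matrix of the minimal polynomial of \<open>\<pi>\<close>; it is
  the value of an integer polynomial \<open>P\<^sub>h\<close> in the \<open>b\<^sub>i\<close> and the \<open>c\<^sub>k\<close>. Rescaling by powers of \<open>\<pi>\<close> makes all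
  arguments of \<open>P\<^sub>h\<close> integral, so it suffices to bound the value of every monomial of \<open>P\<^sub>h\<close>.

  The point is that a monomial involving only those \<open>c\<^sub>k\<close> with \<open>q = p\<^sup>t\<close> dividing \<open>k\<close> has a coefficient \<open>d\<close>
  with \<open>q\<close> dividing \<open>h d\<close>. To see this, set the other \<open>c\<^sub>k\<close> to zero. Every matrix commuting with the
  resulting \<open>C\<close> has its diagonal constant on blocks of length \<open>q\<close>, so its trace is divisible by \<open>q\<close>. This
  applies to the adjugate of \<open>X - M\<close>, whose trace is the derivative of the characteristic polynomial
  of \<open>M\<close>.
\<close>

subsection \<open>Integer polynomials in countably many variables\<close>

text \<open>The argument inspects the integer coefficient of each monomial and evaluates the same
  polynomial in several rings, so polynomials are formal objects. Additively they are the free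
  abelian group on exponent vectors, which makes \<open>frag_induction\<close> available.\<close>

type_synonym int_mpoly = "(nat \<Rightarrow>\<^sub>0 nat) \<Rightarrow>\<^sub>0 int"

definition monom_eval :: "(nat \<Rightarrow> 'a::comm_ring_1) \<Rightarrow> (nat \<Rightarrow>\<^sub>0 nat) \<Rightarrow> 'a" where
  "monom_eval \<phi> m = (\<Prod>i\<in>Poly_Mapping.keys m. \<phi> i ^ Poly_Mapping.lookup m i)"

definition mpoly_eval :: "(nat \<Rightarrow> 'a::comm_ring_1) \<Rightarrow> int_mpoly \<Rightarrow> 'a" where
  "mpoly_eval \<phi> P = (\<Sum>m\<in>Poly_Mapping.keys P. of_int (Poly_Mapping.lookup P m) * monom_eval \<phi> m)"

definition mvar :: "nat \<Rightarrow> int_mpoly" where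
  "mvar i = Poly_Mapping.single (Poly_Mapping.single i 1) 1"

lemma monom_eval_superset:
  assumes "finite S" "Poly_Mapping.keys m \<subseteq> S"
  shows "monom_eval \<phi> m = (\<Prod>i\<in>S. \<phi> i ^ Poly_Mapping.lookup m i)"
  unfolding monom_eval_def
  by (rule prod.mono_neutral_left) (use assms in \<open>auto simp: in_keys_iff\<close>)

lemma monom_eval_add: "monom_eval \<phi> (a + b) = monom_eval \<phi> a * monom_eval \<phi> b"
proof -
  let ?S = "Poly_Mapping.keys a \<union> Poly_Mapping.keys b"
  have "Poly_Mapping.keys (a + b) \<subseteq> ?S"
    by (rule keys_add)
  then show ?thesis
    by (simp add: monom_eval_superset[of ?S] lookup_add power_add prod.distrib)
qed

lemma mpoly_eval_add: "mpoly_eval \<phi> (P + Q) = mpoly_eval \<phi> P + mpoly_eval \<phi> Q"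
  unfolding mpoly_eval_def
  by (rule setsum_keys_plus_distrib) (auto simp: algebra_simps)

lemma mpoly_eval_uminus: "mpoly_eval \<phi> (- P) = - mpoly_eval \<phi> P"
  unfolding mpoly_eval_def by (simp add: sum_negf)

lemma mpoly_eval_diff: "mpoly_eval \<phi> (P - Q) = mpoly_eval \<phi> P - mpoly_eval \<phi> Q"
  using mpoly_eval_add[of \<phi> P "- Q"] by (simp add: mpoly_eval_uminus)

lemma mpoly_eval_0 [simp]: "mpoly_eval \<phi> 0 = 0"
  by (simp add: mpoly_eval_def)

lemma mpoly_eval_monom [simp]: "mpoly_eval \<phi> (frag_of m) = monom_eval \<phi> m"
  by (simp add: mpoly_eval_def)

text \<open>Both sides are additive in each factor, so two inductions over the free abelian group
  leave only products of two monomials.\<close>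

lemma mpoly_eval_mult: "mpoly_eval \<phi> (P * Q) = mpoly_eval \<phi> P * mpoly_eval \<phi> Q"
proof -
  have monom: "mpoly_eval \<phi> (frag_of x * Q) = monom_eval \<phi> x * mpoly_eval \<phi> Q" for x
    using subset_UNIV
  proof (induction Q rule: frag_induction)
    case (one y)
    then show ?case
      by (simp add: mult_single monom_eval_add)
  qed (simp_all add: right_diff_distrib mpoly_eval_diff)
  show ?thesis
    using subset_UNIV
  proof (induction P rule: frag_induction)
    case (one x)
    then show ?case by (simp add: monom)
  qed (simp_all add: left_diff_distrib mpoly_eval_diff)
qed

lemma comm_ring_hom_mpoly_eval: "comm_ring_hom (mpoly_eval \<phi>)"
proof
  show "mpoly_eval \<phi> 1 = 1"
    using mpoly_eval_monom[of \<phi> 0] by (simp add: monom_eval_def)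
qed (simp_all add: mpoly_eval_add mpoly_eval_mult)

lemma mpoly_eval_mvar [simp]: "mpoly_eval \<phi> (mvar i) = \<phi> i"
  unfolding mvar_def by (simp add: monom_eval_def)

text \<open>Ring homomorphisms respect integer coefficients. This lets one universal polynomial be
  compared across \<open>K\<close>, \<open>L\<close> and the separable closure.\<close>

lemma hom_mpoly_eval:
  assumes "comm_ring_hom \<psi>"
  shows "\<psi> (mpoly_eval \<phi> P) = mpoly_eval (\<lambda>i. \<psi> (\<phi> i)) P"
proof -
  interpret comm_ring_hom \<psi> by fact
  show ?thesis
    by (simp add: mpoly_eval_def monom_eval_def hom_distribs)
qed

lemma mvar_power: "mvar i ^ k = frag_of (Poly_Mapping.single i k)"
  by (induction k) (simp_all add: mvar_def mult_single flip: single_add)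

lemma prod_frag_of: "(\<Prod>i\<in>S. frag_of (m i)) = (frag_of (\<Sum>i\<in>S. m i) :: 'a::comm_monoid_add \<Rightarrow>\<^sub>0 int)"
  by (induction S rule: infinite_finite_induct) (simp_all add: mult_single)

lemma monom_eval_mvar: "monom_eval mvar m = frag_of m"
proof -
  have "m = (\<Sum>i\<in>Poly_Mapping.keys m. Poly_Mapping.single i (Poly_Mapping.lookup m i))"
    by (rule poly_mapping_eqI)
       (auto simp: lookup_sum lookup_single when_def in_keys_iff sum.delta[OF finite_keys])
  then show ?thesis
    by (simp add: monom_eval_def mvar_power prod_frag_of)
qed

text \<open>Setting variables to zero kills every monomial containing one of them and fixes all
  others. Coefficients of the generic polynomial can therefore be read off after
  specialisation.\<close>

lemma lookup_mpoly_eval_restrict: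
  assumes "\<And>i. i \<in> Poly_Mapping.keys m \<Longrightarrow> \<not> N i"
  shows "Poly_Mapping.lookup (mpoly_eval (\<lambda>i. if N i then 0 else mvar i) P) m = Poly_Mapping.lookup P m"
  using subset_UNIV
proof (induction P rule: frag_induction)
  case (one x)
  have "monom_eval (\<lambda>i. if N i then 0 else mvar i) x = (if \<exists>i\<in>Poly_Mapping.keys x. N i then 0 else frag_of x)"
  proof (cases "\<exists>i\<in>Poly_Mapping.keys x. N i")
    case True
    then show ?thesis
      by (auto simp: monom_eval_def in_keys_iff intro!: prod_zero)
  next
    case False
    then have "monom_eval (\<lambda>i. if N i then 0 else mvar i) x = monom_eval mvar x"
      unfolding monom_eval_def by (intro prod.cong) auto
    with False show ?thesis by (simp add: monom_eval_mvar)
  qed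
  then show ?case
    using assms by (auto simp: lookup_single when_def)
qed (simp_all add: mpoly_eval_diff lookup_minus)

subsection \<open>Matrices commuting with a companion matrix\<close>

text \<open>Multiplication by \<open>X\<close> modulo the monic polynomial of degree
  \<open>n\<close> with lower coefficients \<open>f 0, ..., f (n - 1)\<close>, in the basis of
  powers of \<open>X\<close>.\<close>

definition companion :: "nat \<Rightarrow> (nat \<Rightarrow> 'a::comm_ring_1) \<Rightarrow> 'a mat" where
  "companion n f = Matrix.mat n n (\<lambda>(a, b). if Suc b < n then (if a = Suc b then 1 else 0) else - f a)"

text \<open>The value at \<open>C\<close> of the polynomial with coefficients
  \<open>g 0, ..., g (k - 1)\<close>. Recursion lets the zero matrix take its dimension from
  \<open>C\<close>.\<close>

primrec mat_combination :: "'a::comm_ring_1 mat \<Rightarrow> (nat \<Rightarrow> 'a) \<Rightarrow> nat \<Rightarrow> 'a mat" where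
  "mat_combination C g 0 = 0\<^sub>m (dim_row C) (dim_row C)"
| "mat_combination C g (Suc k) = g k \<cdot>\<^sub>m (C ^\<^sub>m k) + mat_combination C g k"

lemma companion_carrier [simp]: "companion n f \<in> carrier_mat n n"
  by (simp add: companion_def)

lemma dim_companion [simp]: "dim_row (companion n f) = n" "dim_col (companion n f) = n"
  by (simp_all add: companion_def)

lemma mat_combination_carrier [simp]:
  "C \<in> carrier_mat n n \<Longrightarrow> mat_combination C g k \<in> carrier_mat n n"
  by (induction k) auto

lemma mat_combination_commute:
  fixes C :: "'a::comm_ring_1 mat"
  assumes C: "C \<in> carrier_mat n n"
  shows "C * mat_combination C g k = mat_combination C g k * C"
proof (induction k)
  case 0
  then show ?case using C by simp
next
  case (Suc k)
  have pow: "C ^\<^sub>m k \<in> carrier_mat n n" using C by simp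
  have "C * (C ^\<^sub>m k) = C ^\<^sub>m k * C"
  proof (induction k)
    case (Suc k)
    have "C * C ^\<^sub>m Suc k = (C * C ^\<^sub>m k) * C"
      using C by (simp add: assoc_mult_mat[of _ n n _ n _ n])
    with Suc show ?case by simp
  qed (use C in simp)
  with Suc C pow show ?case
    by (simp add: mult_add_distrib_mat[of _ n n _ n] add_mult_distrib_mat[of _ n n _ _ n]
        mult_smult_distrib[of _ n n _ n] mult_smult_assoc_mat[of _ n n _ n])
qed

text \<open>Comparing the entries of \<open>C W = W C\<close> below the diagonal shows that the diagonal of \<open>W\<close> is
  constant on blocks of length \<open>q\<close>.\<close>

lemma dvd_trace_of_commuting:
  fixes W :: "'a::comm_ring_1 mat"
  assumes W: "W \<in> carrier_mat n n" and comm: "companion n f * W = W * companion n f"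
    and q: "q dvd n" and f: "\<And>a. a < n \<Longrightarrow> \<not> q dvd a \<Longrightarrow> f a = 0"
  shows "of_nat q dvd (\<Sum>i<n. W $$ (i, i))"
proof (cases "n = 0")
  case False
  then have "q > 0" using q by (auto intro: Nat.gr0I)
  \<comment> \<open>Row \<open>Suc b\<close> of the companion matrix has only its subdiagonal one,
    since the entry \<open>- f (Suc b)\<close> in the last column vanishes; column \<open>b\<close>
    is a unit vector because \<open>Suc b < n\<close>.\<close>
  have step: "W $$ (Suc b, Suc b) = W $$ (b, b)" if b: "Suc b < n" "\<not> q dvd Suc b" for b
  proof -
    have "(companion n f * W) $$ (Suc b, b) = (\<Sum>i<n. companion n f $$ (Suc b, i) * W $$ (i, b))"
      using b W by (simp add: scalar_prod_def atLeast0LessThan)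
    also have "\<dots> = (\<Sum>i<n. if i = b then W $$ (i, b) else 0)"
      by (rule sum.cong) (use b f in \<open>auto simp: companion_def\<close>)
    also have "\<dots> = W $$ (b, b)" using b by simp
    finally have 1: "(companion n f * W) $$ (Suc b, b) = W $$ (b, b)" .
    have "(W * companion n f) $$ (Suc b, b) = (\<Sum>i<n. W $$ (Suc b, i) * companion n f $$ (i, b))"
      using b W by (simp add: scalar_prod_def atLeast0LessThan)
    also have "\<dots> = (\<Sum>i<n. if i = Suc b then W $$ (Suc b, i) else 0)"
      by (rule sum.cong) (use b in \<open>auto simp: companion_def\<close>)
    also have "\<dots> = W $$ (Suc b, Suc b)" using b by simp
    finally show ?thesis using 1 comm by simp
  qed
  obtain l where n: "n = q * l" using q by blast
  have block: "W $$ (q * k + i, q * k + i) = W $$ (q * k, q * k)" if "k < l" "i < q" for k i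
    using \<open>i < q\<close>
  proof (induction i)
    case (Suc i)
    have "q * k + Suc i < q * Suc k" using Suc by simp
    also have "\<dots> \<le> n" using \<open>k < l\<close> unfolding n by (intro mult_le_mono2) simp
    finally have "Suc (q * k + i) < n" by simp
    moreover have "\<not> q dvd Suc (q * k + i)"
    proof
      assume "q dvd Suc (q * k + i)"
      then have "q dvd q * k + Suc i" by simp
      then have "q dvd Suc i" by (subst (asm) dvd_add_right_iff) auto
      with Suc show False by (auto dest: dvd_imp_le)
    qed
    ultimately show ?case using step Suc by simp
  qed simp
  have shift: "(\<Sum>i = k * q..<k * q + q. W $$ (i, i)) = (\<Sum>i<q. W $$ (k * q + i, k * q + i))" for k
    using sum.shift_bounds_nat_ivl[of "\<lambda>i. W $$ (i, i)" 0 "k * q" q]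
    by (simp add: atLeast0LessThan add.commute)
  have "(\<Sum>i<n. W $$ (i, i)) = (\<Sum>k<l. \<Sum>i<q. W $$ (q * k + i, q * k + i))"
    unfolding n using sum.nat_group[of "\<lambda>i. W $$ (i, i)" q l] shift
    by (simp add: mult.commute)
  also have "\<dots> = (\<Sum>k<l. of_nat q * W $$ (q * k, q * k))"
    by (rule sum.cong) (simp_all add: block)
  also have "of_nat q dvd \<dots>" by (simp flip: sum_distrib_left)
  finally show ?thesis .
qed simp

section \<open>Adjugates and derivatives of characteristic polynomials\<close>

text \<open>A diagonal cofactor of \<open>X - M\<close> has sign one and is the characteristic
  polynomial of a principal minor; these add up to the derivative.\<close>

lemma pderiv_char_poly_trace_adj:
  fixes M :: "'a::idom mat"
  assumes M: "M \<in> carrier_mat n n"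
  shows "pderiv (char_poly M) = (\<Sum>i<n. adj_mat (char_poly_matrix M) $$ (i, i))"
  unfolding pderiv_char_poly[OF M]
proof (rule sum.cong[OF refl])
  fix i assume i: "i \<in> {..<n}"
  have "mat_delete (char_poly_matrix M) i i = char_poly_matrix (mat_delete M i i)"
    using i M by (auto simp: mat_delete_def char_poly_matrix_def)
  moreover have "char_poly_matrix M \<in> carrier_mat n n" using M by simp
  ultimately show "char_poly (mat_delete M i i) = adj_mat (char_poly_matrix M) $$ (i, i)"
    using i by (simp add: adj_mat_def cofactor_def char_poly_def)
qed

text \<open>The adjugate is \<open>det Z\<close> times the inverse of \<open>Z\<close> over the
  fraction field. To stay inside the domain, the identity is multiplied by \<open>det Z\<close>,
  which is cancelled entrywise at the end.\<close>

lemma adj_mat_commute: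
  fixes Z :: "'a::idom mat"
  assumes Z: "Z \<in> carrier_mat n n" and C: "C \<in> carrier_mat n n"
    and comm: "C * Z = Z * C" and det: "det Z \<noteq> 0"
  shows "C * adj_mat Z = adj_mat Z * C"
proof -
  note J = adj_mat[OF Z]
  have "det Z \<cdot>\<^sub>m (C * adj_mat Z) = (adj_mat Z * Z) * (C * adj_mat Z)"
    using J C by (simp add: mult_smult_assoc_mat[of _ n n _ n])
  also have "\<dots> = adj_mat Z * (Z * C) * adj_mat Z"
    using J(1) C Z by (simp add: assoc_mult_mat[of _ n n _ n _ n])
  also have "\<dots> = adj_mat Z * (C * Z) * adj_mat Z" by (simp add: comm)
  also have "\<dots> = (adj_mat Z * C) * (Z * adj_mat Z)"
    using J(1) C Z by (simp add: assoc_mult_mat[of _ n n _ n _ n])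
  also have "\<dots> = det Z \<cdot>\<^sub>m (adj_mat Z * C)"
    using J C by (simp add: mult_smult_distrib[of _ n n _ n])
  finally have eq: "det Z \<cdot>\<^sub>m (C * adj_mat Z) = det Z \<cdot>\<^sub>m (adj_mat Z * C)" .
  show ?thesis
  proof (rule eq_matI)
    fix i j assume ij: "i < dim_row (adj_mat Z * C)" "j < dim_col (adj_mat Z * C)"
    have "(det Z \<cdot>\<^sub>m (C * adj_mat Z)) $$ (i, j) = (det Z \<cdot>\<^sub>m (adj_mat Z * C)) $$ (i, j)"
      by (simp only: eq)
    then show "(C * adj_mat Z) $$ (i, j) = (adj_mat Z * C) $$ (i, j)"
      using ij J(1) C det by simp
  qed (use J(1) C in simp_all)
qed

lemma char_poly_matrix_commute:
  fixes M :: "'a::comm_ring_1 mat"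
  assumes M: "M \<in> carrier_mat n n" and C: "C \<in> carrier_mat n n" and comm: "C * M = M * C"
  shows "map_mat (\<lambda>a. [:a:]) C * char_poly_matrix M = char_poly_matrix M * map_mat (\<lambda>a. [:a:]) C"
proof -
  interpret lift: comm_ring_hom "\<lambda>a::'a. [:a:]" by unfold_locales simp_all
  let ?c = "map_mat (\<lambda>a. [:a:]) C" and ?m = "map_mat (\<lambda>a. [:a:]) M"
  have c: "?c \<in> carrier_mat n n" and m: "?m \<in> carrier_mat n n" using M C by simp_all
  have cm: "?c * ?m = ?m * ?c"
    using lift.mat_hom_mult[OF C M] lift.mat_hom_mult[OF M C] comm by simp
  have Z: "char_poly_matrix M = [:0, 1:] \<cdot>\<^sub>m 1\<^sub>m n + (- 1) \<cdot>\<^sub>m ?m"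
    using M by (auto simp: char_poly_matrix_def)
  show ?thesis
    unfolding Z using c m cm
    by (simp add: mult_add_distrib_mat[of _ n n _ n] add_mult_distrib_mat[of _ n n _ _ n]
        mult_smult_distrib[of _ n n _ n] mult_smult_assoc_mat[of _ n n _ n])
qed

text \<open>The trace of the adjugate makes the derivative divisible by \<open>q\<close>.
  Differentiation multiplies the coefficient of degree \<open>n - h\<close> by \<open>n - h\<close>,
  and \<open>q dvd n\<close> turns this factor into \<open>- h\<close> modulo
  \<open>q\<close>.\<close>

lemma dvd_coeff_char_poly_companion:
  fixes f :: "nat \<Rightarrow> 'a::idom"
  assumes q: "q dvd n" and f: "\<And>a. a < n \<Longrightarrow> \<not> q dvd a \<Longrightarrow> f a = 0" and h: "h \<le> n"
  shows "of_nat q dvd of_nat h * coeff (char_poly (mat_combination (companion n f) g k)) (n - h)"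
proof -
  let ?C = "companion n f" and ?M = "mat_combination (companion n f) g k"
  let ?Z = "char_poly_matrix ?M"
  have M: "?M \<in> carrier_mat n n" by simp
  have lift: "map_mat (\<lambda>a. [:a:]) ?C = companion n (\<lambda>a. [:f a:])"
    by (rule eq_matI) (auto simp: companion_def)
  have "degree (char_poly ?M) = n \<and> coeff (char_poly ?M) n = 1"
    by (rule degree_monic_char_poly) simp
  then have "det ?Z \<noteq> 0" unfolding char_poly_def by auto
  then have "companion n (\<lambda>a. [:f a:]) * adj_mat ?Z = adj_mat ?Z * companion n (\<lambda>a. [:f a:])"
    using char_poly_matrix_commute[OF M companion_carrier mat_combination_commute[OF companion_carrier]]
    unfolding lift by (intro adj_mat_commute[of _ n]) simp_all
  then have "of_nat q dvd pderiv (char_poly ?M)"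
    unfolding pderiv_char_poly_trace_adj[OF M]
    by (rule dvd_trace_of_commuting[rotated]) (use q f adj_mat(1)[of ?Z n] in auto)
  then obtain r where r: "pderiv (char_poly ?M) = of_nat q * r" ..
  have q_dvd: "of_nat q dvd of_nat (n - h) * coeff (char_poly ?M) (n - h)"
  proof (cases "n - h")
    case (Suc a)
    have "of_nat (n - h) * coeff (char_poly ?M) (n - h) = coeff (pderiv (char_poly ?M)) a"
      unfolding Suc by (simp add: coeff_pderiv)
    also have "\<dots> = of_nat q * coeff r a"
      unfolding r by (simp add: of_nat_poly)
    finally show ?thesis by simp
  qed simp
  have "of_nat h * coeff (char_poly ?M) (n - h)
      = of_nat n * coeff (char_poly ?M) (n - h) - of_nat (n - h) * coeff (char_poly ?M) (n - h)"
    using h by (simp add: of_nat_diff algebra_simps)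
  moreover have "(of_nat q :: 'a) dvd of_nat n" using q by (auto simp: dvd_def)
  ultimately show ?thesis
    using q_dvd by (simp add: dvd_diff)
qed

subsection \<open>Elementary symmetric functions of values at roots\<close>

definition vandermonde :: "nat \<Rightarrow> (nat \<Rightarrow> 'a::comm_ring_1) \<Rightarrow> 'a mat" where
  "vandermonde n y = Matrix.mat n n (\<lambda>(k, b). y k ^ b)"

definition diagonal :: "nat \<Rightarrow> (nat \<Rightarrow> 'a::comm_ring_1) \<Rightarrow> 'a mat" where
  "diagonal n w = Matrix.mat n n (\<lambda>(i, j). if i = j then w i else 0)"

lemma vandermonde_carrier [simp]: "vandermonde n y \<in> carrier_mat n n"
  by (simp add: vandermonde_def)

lemma diagonal_carrier [simp]: "diagonal n w \<in> carrier_mat n n"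
  by (simp add: diagonal_def)

lemma diagonal_mult_index:
  assumes "A \<in> carrier_mat n n" "i < n" "j < n"
  shows "(diagonal n w * A) $$ (i, j) = w i * A $$ (i, j)"
proof -
  have "(diagonal n w * A) $$ (i, j) = (\<Sum>k<n. diagonal n w $$ (i, k) * A $$ (k, j))"
    using assms by (simp add: scalar_prod_def atLeast0LessThan diagonal_def)
  also have "\<dots> = (\<Sum>k<n. if k = i then w i * A $$ (k, j) else 0)"
    by (rule sum.cong) (use assms in \<open>auto simp: diagonal_def\<close>)
  also have "\<dots> = w i * A $$ (i, j)" using assms by simp
  finally show ?thesis .
qed

text \<open>The powers of a root form a left eigenvector of the companion matrix: multiplication
  shifts the exponents, and the last column uses the equation of the root.\<close>

lemma vandermonde_companion:
  fixes y :: "nat \<Rightarrow> 'a::comm_ring_1"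
  assumes root: "\<And>k. k < n \<Longrightarrow> y k ^ n + (\<Sum>a<n. f a * y k ^ a) = 0"
  shows "vandermonde n y * companion n f = diagonal n y * vandermonde n y"
proof (rule eq_matI)
  fix k b assume "k < dim_row (diagonal n y * vandermonde n y)" "b < dim_col (diagonal n y * vandermonde n y)"
  then have kb: "k < n" "b < n" by (auto simp: diagonal_def vandermonde_def)
  have "(vandermonde n y * companion n f) $$ (k, b) = (\<Sum>a<n. y k ^ a * companion n f $$ (a, b))"
    using kb by (simp add: scalar_prod_def atLeast0LessThan vandermonde_def)
  also have "\<dots> = y k ^ Suc b"
  proof (cases "Suc b < n")
    case True
    have "(\<Sum>a<n. y k ^ a * companion n f $$ (a, b)) = (\<Sum>a<n. if a = Suc b then y k ^ a else 0)"
      by (rule sum.cong) (use True in \<open>auto simp: companion_def\<close>)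
    with True show ?thesis by simp
  next
    case False
    then have n: "n = Suc b" using kb by simp
    have "(\<Sum>a<n. y k ^ a * companion n f $$ (a, b)) = - (\<Sum>a<n. f a * y k ^ a)"
      unfolding sum_negf[symmetric] by (rule sum.cong) (use n in \<open>auto simp: companion_def\<close>)
    moreover have "y k ^ n = - (\<Sum>a<n. f a * y k ^ a)"
      using root[OF kb(1)] by (rule eq_neg_iff_add_eq_0[THEN iffD2])
    ultimately show ?thesis
      unfolding n[symmetric] by simp
  qed
  also have "\<dots> = (diagonal n y * vandermonde n y) $$ (k, b)"
    unfolding diagonal_mult_index[OF vandermonde_carrier kb] using kb by (simp add: vandermonde_def)
  finally show "(vandermonde n y * companion n f) $$ (k, b) = (diagonal n y * vandermonde n y) $$ (k, b)" .
qed (simp_all add: diagonal_def vandermonde_def)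

lemma diagonal_mult: "diagonal n w * diagonal n w' = diagonal n (\<lambda>i. w i * w' i)"
proof (rule eq_matI)
  fix i j assume "i < dim_row (diagonal n (\<lambda>i. w i * w' i))" "j < dim_col (diagonal n (\<lambda>i. w i * w' i))"
  then have "i < n" "j < n" by (auto simp: diagonal_def)
  then show "(diagonal n w * diagonal n w') $$ (i, j) = diagonal n (\<lambda>i. w i * w' i) $$ (i, j)"
    by (simp add: diagonal_mult_index[OF diagonal_carrier]) (simp add: diagonal_def)
qed (simp_all add: diagonal_def)

lemma intertwine_mat_combination:
  fixes C V :: "'a::comm_ring_1 mat"
  assumes C: "C \<in> carrier_mat n n" and V: "V \<in> carrier_mat n n" and VC: "V * C = diagonal n y * V"
  shows "V * mat_combination C g N = diagonal n (\<lambda>k. \<Sum>i<N. g i * y k ^ i) * V"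
proof -
  have pow: "V * (C ^\<^sub>m i) = diagonal n (\<lambda>k. y k ^ i) * V" for i
  proof (induction i)
    case 0
    have "diagonal n (\<lambda>k. 1::'a) = 1\<^sub>m n" by (auto simp: diagonal_def)
    then show ?case using C V by simp
  next
    case (Suc i)
    have "V * C ^\<^sub>m Suc i = (V * C ^\<^sub>m i) * C"
      using C V by (simp add: assoc_mult_mat[of _ n n _ n _ n])
    also have "\<dots> = diagonal n (\<lambda>k. y k ^ i) * (V * C)"
      unfolding Suc using C V by (simp add: assoc_mult_mat[of _ n n _ n _ n])
    also have "\<dots> = diagonal n (\<lambda>k. y k ^ i) * diagonal n y * V"
      unfolding VC using C V by (simp add: assoc_mult_mat[of _ n n _ n _ n])
    finally show ?case by (simp add: diagonal_mult mult.commute)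
  qed
  show ?thesis
  proof (induction N)
    case 0
    have "diagonal n (\<lambda>k. 0::'a) = 0\<^sub>m n n" by (auto simp: diagonal_def)
    then show ?case using C V by simp
  next
    case (Suc N)
    have D: "diagonal n (\<lambda>k. \<Sum>i<Suc N. g i * y k ^ i)
        = g N \<cdot>\<^sub>m diagonal n (\<lambda>k. y k ^ N) + diagonal n (\<lambda>k. \<Sum>i<N. g i * y k ^ i)"
      by (auto simp: diagonal_def)
    show ?case
      unfolding D using C V Suc pow
      by (simp add: mult_add_distrib_mat[of _ n n _ n] add_mult_distrib_mat[of _ n n _ _ n]
          mult_smult_distrib[of _ n n _ n] mult_smult_assoc_mat[of _ n n _ n])
  qed
qed

text \<open>A kernel vector would be the coefficient vector of a nonzero polynomial of degree below
  \<open>n\<close> with \<open>n\<close> distinct roots.\<close>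

lemma det_vandermonde_nonzero:
  fixes y :: "nat \<Rightarrow> 'a::field"
  assumes inj: "inj_on y {..<n}"
  shows "det (vandermonde n y) \<noteq> 0"
proof
  assume "det (vandermonde n y) = 0"
  then obtain v where v: "v \<in> carrier_vec n" "v \<noteq> 0\<^sub>v n" "vandermonde n y *\<^sub>v v = 0\<^sub>v n"
    using det_0_iff_vec_prod_zero_field[OF vandermonde_carrier] by blast
  define P where "P = (\<Sum>b<n. monom (v $ b) b)"
  have coeff_P: "coeff P b = (if b < n then v $ b else 0)" for b
    unfolding P_def by (simp add: coeff_sum if_distrib[of "\<lambda>x. coeff x _"] cong: if_cong)
  have "poly P (y k) = 0" if "k < n" for k
  proof -
    have "(vandermonde n y *\<^sub>v v) $ k = (\<Sum>b<n. y k ^ b * v $ b)"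
      using that v(1) by (simp add: vandermonde_def scalar_prod_def atLeast0LessThan)
    then show ?thesis
      using that v(3) by (simp add: P_def poly_sum poly_monom mult.commute)
  qed
  then have roots: "y ` {..<n} \<subseteq> {x. poly P x = 0}" by auto
  have "P \<noteq> 0"
  proof
    assume "P = 0"
    then have "v $ b = 0" if "b < n" for b using coeff_P[of b] that by simp
    with v(1,2) show False by (auto intro: eq_vecI)
  qed
  then have "n \<le> degree P"
    using card_mono[OF poly_roots_finite roots] poly_roots_degree[of P] card_image[OF inj] by simp
  with \<open>P \<noteq> 0\<close> have "coeff P (degree P) = 0" unfolding coeff_P by simp
  with \<open>P \<noteq> 0\<close> show False by simp
qed

text \<open>For distinct roots the Vandermonde matrix is invertible and diagonalises the companion
  matrix, hence every polynomial in it.\<close>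

lemma char_poly_combination_roots:
  fixes y :: "nat \<Rightarrow> 'a::field"
  assumes inj: "inj_on y {..<n}" and root: "\<And>k. k < n \<Longrightarrow> y k ^ n + (\<Sum>a<n. f a * y k ^ a) = 0"
  shows "char_poly (mat_combination (companion n f) g N) = (\<Prod>k<n. [:- (\<Sum>i<N. g i * y k ^ i), 1:])"
proof -
  let ?V = "vandermonde n y" and ?M = "mat_combination (companion n f) g N"
  let ?D = "diagonal n (\<lambda>k. \<Sum>i<N. g i * y k ^ i)"
  have "?V \<in> Units (ring_mat TYPE('a) n ())"
    by (rule det_non_zero_imp_unit[OF vandermonde_carrier det_vandermonde_nonzero[OF inj]])
  then obtain Q where Q: "Q \<in> carrier_mat n n" "Q * ?V = 1\<^sub>m n" "?V * Q = 1\<^sub>m n"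
    by (auto simp: Units_def ring_mat_simps)
  have VM: "?V * ?M = ?D * ?V"
    by (intro intertwine_mat_combination vandermonde_companion root) simp_all
  have "Q * ?D * ?V = Q * (?V * ?M)"
    unfolding VM using Q(1) by (simp add: assoc_mult_mat[of _ n n _ n _ n])
  also have "\<dots> = (Q * ?V) * ?M"
    using Q(1) by (simp add: assoc_mult_mat[of _ n n _ n _ n, symmetric])
  also have "\<dots> = ?M"
    unfolding Q(2) by (rule left_mult_one_mat[OF mat_combination_carrier[OF companion_carrier]])
  finally have "similar_mat ?M ?D"
    using Q by (intro similar_matI[of _ _ Q ?V n]) simp_all
  then have "char_poly ?M = char_poly ?D" by (rule char_poly_similar)
  also have "\<dots> = (\<Prod>a \<leftarrow> diag_mat ?D. [:- a, 1:])"
    by (rule char_poly_upper_triangular[OF diagonal_carrier]) (auto simp: diagonal_def upper_triangular_def)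
  also have "diag_mat ?D = List.map (\<lambda>k. \<Sum>i<N. g i * y k ^ i) [0..<n]"
    by (auto simp: diag_mat_def diagonal_def)
  finally show ?thesis
    using prod.distinct_set_conv_list[of "[0..<n]" "\<lambda>k. [:- (\<Sum>i<N. g i * y k ^ i), 1:]"]
    by (simp add: comp_def atLeast0LessThan)
qed

section \<open>Vieta's formula and the universal polynomial\<close>

text \<open>In the expansion, \<open>S\<close> records the factors that contribute their constant
  term; the others contribute a power of the variable of degree \<open>card (I - S)\<close>.\<close>

lemma coeff_prod_linear_factors:
  fixes w :: "'i \<Rightarrow> 'a::comm_ring_1"
  assumes I: "finite I" and h: "h \<le> card I"
  shows "coeff (\<Prod>i\<in>I. [:- w i, 1:]) (card I - h) = (-1) ^ h * elem_sym h I w"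
proof -
  have "(\<Prod>i\<in>I. [:- w i, 1:]) = (\<Prod>i\<in>I. [:- w i:] + monom 1 1)"
    by (simp add: monom_altdef)
  also have "\<dots> = (\<Sum>S\<in>Pow I. (\<Prod>i\<in>S. [:- w i:]) * (\<Prod>i\<in>I - S. monom 1 1))"
    by (rule prod_add[OF I])
  also have "\<dots> = (\<Sum>S\<in>Pow I. monom (\<Prod>i\<in>S. - w i) (card (I - S)))"
  proof (rule sum.cong[OF refl])
    fix S assume "S \<in> Pow I"
    have "(\<Prod>i\<in>S. [:- w i:]) = [:\<Prod>i\<in>S. - w i:]"
      by (induction S rule: infinite_finite_induct) simp_all
    then show "(\<Prod>i\<in>S. [:- w i:]) * (\<Prod>i\<in>I - S. monom 1 1) = monom (\<Prod>i\<in>S. - w i) (card (I - S))"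
      by (simp add: monom_power smult_monom)
  qed
  finally have "coeff (\<Prod>i\<in>I. [:- w i, 1:]) (card I - h)
      = (\<Sum>S\<in>Pow I. if card (I - S) = card I - h then \<Prod>i\<in>S. - w i else 0)"
    by (simp add: coeff_sum)
  also have "\<dots> = (\<Sum>S | S \<subseteq> I \<and> card S = h. \<Prod>i\<in>S. - w i)"
    unfolding sum.inter_filter[OF finite_Pow_iff[THEN iffD2, OF I], symmetric]
  proof (rule sum.cong)
    have "card (I - S) = card I - h \<longleftrightarrow> card S = h" if "S \<subseteq> I" for S
      using that h I card_mono[OF I that] by (auto simp: card_Diff_subset finite_subset)
    then show "{S \<in> Pow I. card (I - S) = card I - h} = {S. S \<subseteq> I \<and> card S = h}" by auto
  qed simp
  also have "\<dots> = (-1) ^ h * elem_sym h I w"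
    unfolding elem_sym_def sum_distrib_left
    by (rule sum.cong) (auto simp: prod_uminus)
  finally show ?thesis .
qed

text \<open>Variables \<open>0, \<dots>, n - 1\<close> stand for the lower coefficients of a monic polynomial of degree \<open>n\<close>,
  variables \<open>n, \<dots>, 2 n - 1\<close> for the coefficients of a polynomial evaluated at its roots.\<close>

definition univ_esym :: "nat \<Rightarrow> nat \<Rightarrow> int_mpoly" where
  "univ_esym n h = (-1) ^ h *
     coeff (char_poly (mat_combination (companion n mvar) (\<lambda>i. mvar (n + i)) n)) (n - h)"

text \<open>Matrix powers and characteristic polynomials commute with ring homomorphisms, so the
  generic matrix specialises.\<close>

lemma mpoly_eval_univ_esym:
  fixes \<phi> :: "nat \<Rightarrow> 'a::comm_ring_1"
  shows "mpoly_eval \<phi> (univ_esym n h) =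
    (-1) ^ h * coeff (char_poly (mat_combination (companion n \<phi>) (\<lambda>i. \<phi> (n + i)) n)) (n - h)"
proof -
  interpret ev: comm_ring_hom "mpoly_eval \<phi>" by (rule comm_ring_hom_mpoly_eval)
  have C: "map_mat (mpoly_eval \<phi>) (companion n mvar) = companion n \<phi>"
    by (rule eq_matI) (auto simp: companion_def ev.hom_uminus)
  have "map_mat (mpoly_eval \<phi>) (mat_combination (companion n mvar) (\<lambda>i. mvar (n + i)) k)
      = mat_combination (companion n \<phi>) (\<lambda>i. \<phi> (n + i)) k" for k
  proof (induction k)
    case 0
    then show ?case by (auto intro!: eq_matI)
  next
    case (Suc k)
    have "map_mat (mpoly_eval \<phi>) (mvar (n + k) \<cdot>\<^sub>m (companion n mvar ^\<^sub>m k)) = \<phi> (n + k) \<cdot>\<^sub>m (companion n \<phi> ^\<^sub>m k)"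
      unfolding C[symmetric] ev.mat_hom_pow[OF companion_carrier, symmetric]
      by (rule eq_matI) (simp_all add: ev.hom_mult)
    moreover have "map_mat (mpoly_eval \<phi>) (A + B) = map_mat (mpoly_eval \<phi>) A + map_mat (mpoly_eval \<phi>) B"
      if "A \<in> carrier_mat n n" "B \<in> carrier_mat n n" for A B
      using that by (auto intro!: eq_matI simp: ev.hom_add)
    ultimately show ?case using Suc by simp
  qed
  then have "map_poly (mpoly_eval \<phi>) (char_poly (mat_combination (companion n mvar) (\<lambda>i. mvar (n + i)) n))
      = char_poly (mat_combination (companion n \<phi>) (\<lambda>i. \<phi> (n + i)) n)"
    using ev.char_poly_hom[of "mat_combination (companion n mvar) (\<lambda>i. mvar (n + i)) n" n] by simp
  then show ?thesis
    unfolding univ_esym_def ev.hom_mult ev.hom_power ev.hom_uminus ev.hom_one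
    by (simp only: ev.coeff_map_poly_hom[symmetric])
qed

text \<open>The sign in \<open>univ_esym\<close> cancels the one in Vieta's formula. In the
  application the roots are distinct by separability.\<close>

lemma mpoly_eval_univ_esym_roots:
  fixes y :: "nat \<Rightarrow> 'a::field"
  assumes "inj_on y {..<n}" and "\<And>k. k < n \<Longrightarrow> y k ^ n + (\<Sum>a<n. \<phi> a * y k ^ a) = 0" and "h \<le> n"
  shows "mpoly_eval \<phi> (univ_esym n h) = elem_sym h {..<n} (\<lambda>k. \<Sum>i<n. \<phi> (n + i) * y k ^ i)"
proof -
  let ?w = "\<lambda>k. \<Sum>i<n. \<phi> (n + i) * y k ^ i"
  have "char_poly (mat_combination (companion n \<phi>) (\<lambda>i. \<phi> (n + i)) n) = (\<Prod>k<n. [:- ?w k, 1:])"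
    by (rule char_poly_combination_roots) (use assms in auto)
  moreover have "coeff (\<Prod>k<n. [:- ?w k, 1:]) (n - h) = (-1) ^ h * elem_sym h {..<n} ?w"
    using coeff_prod_linear_factors[of "{..<n}" h ?w] assms(3) by simp
  moreover have "(-1) ^ h * ((-1) ^ h * c) = c" for c :: 'a
    by (simp flip: mult.assoc power_mult_distrib)
  ultimately show ?thesis
    unfolding mpoly_eval_univ_esym by (simp only:)
qed

lemma lookup_of_nat_mult:
  fixes P :: int_mpoly
  shows "Poly_Mapping.lookup (of_nat k * P) m = int k * Poly_Mapping.lookup P m"
  by (induction k) (simp_all add: distrib_right lookup_add)

text \<open>Setting to zero the variables \<open>i < n\<close> with \<open>q\<close> not dividing
  \<open>i\<close> yields a companion matrix to which \<open>dvd_coeff_char_poly_companion\<close>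
  applies over \<open>int_mpoly\<close>, and the coefficient of \<open>m\<close> survives.\<close>

lemma dvd_lookup_univ_esym:
  assumes q: "q dvd n" and h: "h \<le> n" and m: "\<And>i. i \<in> Poly_Mapping.keys m \<Longrightarrow> i < n \<Longrightarrow> q dvd i"
  shows "int q dvd int h * Poly_Mapping.lookup (univ_esym n h) m"
proof -
  let ?N = "\<lambda>i. i < n \<and> \<not> q dvd i"
  let ?\<psi> = "\<lambda>i. if ?N i then 0 else mvar i"
  have "of_nat q dvd of_nat h * mpoly_eval ?\<psi> (univ_esym n h)"
    unfolding mpoly_eval_univ_esym mult.left_commute[of "of_nat h"]
    by (intro dvd_mult dvd_coeff_char_poly_companion q h) auto
  then obtain R where R: "of_nat h * mpoly_eval ?\<psi> (univ_esym n h) = of_nat q * R" ..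
  have "int h * Poly_Mapping.lookup (mpoly_eval ?\<psi> (univ_esym n h)) m = int q * Poly_Mapping.lookup R m"
    unfolding lookup_of_nat_mult[symmetric] R ..
  then show ?thesis
    using lookup_mpoly_eval_restrict[of m ?N "univ_esym n h"] m by auto
qed

subsection \<open>Discrete valuations\<close>

locale discretely_valued =
  fixes v :: "'k::field \<Rightarrow> ereal"
  assumes discrete: "discrete_valuation v"
begin

lemma v_eq_infinity_iff [simp]: "v x = \<infinity> \<longleftrightarrow> x = 0"
  using discrete unfolding discrete_valuation_def by blast

lemma v_0 [simp]: "v 0 = \<infinity>"
  by simp

lemma v_mult: "v (x * y) = v x + v y"
  using discrete unfolding discrete_valuation_def by blast

lemma v_add: "min (v x) (v y) \<le> v (x + y)"
  using discrete unfolding discrete_valuation_def by blast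

lemma v_int:
  assumes "x \<noteq> 0"
  obtains k :: int where "v x = ereal (of_int k)"
proof -
  have "v ` (UNIV - {0}) = range (\<lambda>m::int. ereal (of_int m))"
    using discrete unfolding discrete_valuation_def by blast
  then have "v x \<in> range (\<lambda>m::int. ereal (of_int m))" using assms by blast
  with that show thesis by auto
qed

lemma v_1 [simp]: "v 1 = 0"
proof -
  obtain k where k: "v 1 = ereal (of_int k)" by (rule v_int[of 1]) simp
  with v_mult[of 1 1] show ?thesis by simp
qed

lemma v_uminus [simp]: "v (- x) = v x"
proof -
  obtain k where k: "v (- 1) = ereal (of_int k)" by (rule v_int[of "- 1"]) simp
  with v_mult[of "- 1" "- 1"] have "v (- 1) = 0" by (simp add: zero_ereal_def)
  with v_mult[of "- 1" x] show ?thesis by simp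
qed

lemma v_power: "v (x ^ k) = ereal (real k) * v x"
proof (induction k)
  case (Suc k)
  show ?case
  proof (cases "x = 0")
    case False
    then obtain a where a: "v x = ereal (of_int a)" by (rule v_int)
    with Suc show ?thesis by (simp add: v_mult algebra_simps)
  qed simp
qed simp

lemma v_inverse: "x \<noteq> 0 \<Longrightarrow> v (inverse x) = - v x"
proof -
  assume x: "x \<noteq> 0"
  obtain a where a: "v x = ereal (of_int a)" using x by (rule v_int)
  obtain b where b: "v (inverse x) = ereal (of_int b)" by (rule v_int[of "inverse x"]) (use x in simp)
  have "v x + v (inverse x) = 0" using v_mult[of x "inverse x"] x by simp
  with a b show ?thesis by simp
qed

lemma v_power_int:
  assumes "x \<noteq> 0"
  shows "v (x powi k) = ereal (of_int k) * v x"
proof -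
  obtain a where "v x = ereal (of_int a)" using assms by (rule v_int)
  with assms show ?thesis
    by (cases "k \<ge> 0") (simp_all add: power_int_def v_power v_inverse)
qed

lemma v_sum: "(\<And>i. i \<in> S \<Longrightarrow> c \<le> v (f i)) \<Longrightarrow> c \<le> v (sum f S)"
proof (induction S rule: infinite_finite_induct)
  case (insert i S)
  then have "c \<le> min (v (f i)) (v (sum f S))" by simp
  also have "\<dots> \<le> v (f i + sum f S)" by (rule v_add)
  finally show ?case using insert by simp
qed simp_all

text \<open>The condition on \<open>c\<close> covers empty and infinite index sets, whose sum is
  zero and has value \<open>\<infinity>\<close>.\<close>

lemma v_sum_less:
  assumes "c \<noteq> \<infinity>"
  shows "(\<And>i. i \<in> S \<Longrightarrow> c < v (f i)) \<Longrightarrow> c < v (sum f S)"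
proof (induction S rule: infinite_finite_induct)
  case (insert i S)
  then have "c < min (v (f i)) (v (sum f S))" by simp
  also have "\<dots> \<le> v (f i + sum f S)" by (rule v_add)
  finally show ?case using insert by simp
qed (use assms in simp_all)

lemma v_add_eq:
  assumes "v x < v y"
  shows "v (x + y) = v x"
proof (rule antisym)
  have "min (v (x + y)) (v (- y)) \<le> v (x + y + - y)" by (rule v_add)
  then show "v (x + y) \<le> v x"
    using assms by (auto simp: min_le_iff_disj)
  show "v x \<le> v (x + y)"
    using v_add[of x y] assms by (simp add: min_absorb1)
qed

lemma v_sum_unique_min:
  assumes "finite S" "i \<in> S" "v (f i) \<noteq> \<infinity>" "\<And>k. k \<in> S \<Longrightarrow> k \<noteq> i \<Longrightarrow> v (f i) < v (f k)"
  shows "v (sum f S) = v (f i)"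
proof -
  have "v (f i) < v (sum f (S - {i}))"
    by (rule v_sum_less) (use assms in auto)
  then show ?thesis
    using v_add_eq assms(1,2) by (simp add: sum.remove[of S i])
qed

lemma v_prod_nonneg: "(\<And>i. i \<in> S \<Longrightarrow> 0 \<le> v (f i)) \<Longrightarrow> 0 \<le> v (prod f S)"
  by (induction S rule: infinite_finite_induct) (simp_all add: v_mult)

lemma v_of_nat_nonneg: "0 \<le> v (of_nat k)"
proof (induction k)
  case (Suc k)
  then have "0 \<le> min (v 1) (v (of_nat k))" by simp
  also have "\<dots> \<le> v (1 + of_nat k)" by (rule v_add)
  finally show ?case by simp
qed simp

lemma v_of_int_nonneg: "0 \<le> v (of_int k)"
  using v_of_nat_nonneg by (cases k) (simp_all del: of_nat_Suc)

text \<open>This turns divisibility of a monomial's coefficient into the multiple of the value of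
  \<open>p\<close> that occurs in \<open>insep_index\<close>.\<close>

lemma v_of_int_dvd:
  assumes "int p ^ a dvd k"
  shows "ereal (real a) * v (of_nat p) \<le> v (of_int k)"
proof -
  obtain b where "k = int p ^ a * b" using assms ..
  then have "v (of_int k) = ereal (real a) * v (of_nat p) + v (of_int b)"
    by (simp add: v_mult v_power)
  with v_of_int_nonneg[of b] show ?thesis by (simp add: add_increasing2)
qed

end

section \<open>Comparison of values in a totally ramified extension\<close>

text \<open>Here \<open>n\<close> is only the factor relating the two valuations. The equation
  \<open>n = ext_degree \<iota>\<close> is assumed lemma by lemma, so independence of the powers of
  the uniformizer comes from valuations alone.\<close>

locale totally_ramified_ext = K: discretely_valued vK + L: discretely_valued vL + field_hom \<iota>
  for vK :: "'k::field \<Rightarrow> ereal" and vL :: "'l::field \<Rightarrow> ereal" and \<iota> :: "'k \<Rightarrow> 'l" +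
  fixes \<pi> :: 'l and n :: nat
  assumes vL_\<iota>: "vL (\<iota> x) = ereal (real n) * vK x" and vL_\<pi>: "vL \<pi> = 1" and n_pos: "0 < n"
begin

lemma \<pi>_nonzero: "\<pi> \<noteq> 0"
  using vL_\<pi> by auto

lemma vL_monomial: "vL (\<iota> b * \<pi> ^ i) = ereal (real n) * vK b + ereal (real i)"
  by (simp add: L.v_mult vL_\<iota> L.v_power vL_\<pi>)

text \<open>The values of the nonzero terms are pairwise incongruent modulo \<open>n\<close>.\<close>

lemma vL_combination_le:
  assumes i: "i < n"
  shows "vL (\<Sum>k<n. \<iota> (b k) * \<pi> ^ k) \<le> ereal (real n) * vK (b i) + ereal (real i)"
proof (cases "b i = 0")
  case True
  then show ?thesis using n_pos by simp
next
  case False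
  let ?w = "\<lambda>k. vL (\<iota> (b k) * \<pi> ^ k)"
  let ?S = "{k. k < n \<and> b k \<noteq> 0}"
  obtain i0 where i0: "i0 \<in> ?S" and min: "\<And>k. k \<in> ?S \<Longrightarrow> ?w i0 \<le> ?w k"
    using ex_min_if_finite[of "?w ` ?S"] i False by force
  have fin: "?w i0 \<noteq> \<infinity>" using i0 \<pi>_nonzero by simp
  have "?w i0 < ?w k" if k: "k < n" "k \<noteq> i0" for k
  proof (cases "b k = 0")
    case False
    obtain c where c: "vK (b k) = ereal (of_int c)" using False by (rule K.v_int)
    obtain c0 where c0: "vK (b i0) = ereal (of_int c0)" using i0 by (auto elim: K.v_int)
    have "?w i0 \<noteq> ?w k"
    proof
      assume "?w i0 = ?w k"
      then have "real n * of_int c0 + real i0 = real n * of_int c + real k"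
        by (simp add: vL_monomial c c0)
      then have "real_of_int (int n * c0 + int i0) = real_of_int (int n * c + int k)" by simp
      then have "int n * c0 + int i0 = int n * c + int k" by (simp only: of_int_eq_iff)
      then have "(int n * c0 + int i0) mod int n = (int n * c + int k) mod int n" by simp
      with k i0 show False by simp
    qed
    with min[of k] k False show ?thesis by (simp add: less_le)
  qed (use fin in auto)
  then have "vL (\<Sum>k<n. \<iota> (b k) * \<pi> ^ k) = ?w i0"
    using i0 fin by (intro L.v_sum_unique_min) auto
  also have "\<dots> \<le> ?w i" using min[of i] i False by simp
  finally show ?thesis by (simp add: vL_monomial)
qed

text \<open>The sum has value \<open>\<infinity>\<close>, and \<open>vL_combination_le\<close>
  passes this on to every coefficient.\<close>

lemma combination_zero:
  assumes "(\<Sum>k<n. \<iota> (b k) * \<pi> ^ k) = 0" "i < n"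
  shows "b i = 0"
  using vL_combination_le[OF assms(2), of b] n_pos unfolding assms(1)
  by (cases "b i = 0") (auto elim: K.v_int)

end

subsection \<open>Totally ramified extensions and their embeddings\<close>

lemma (in comm_ring_hom) poly_map_poly_sum:
  assumes "degree g < n"
  shows "poly (map_poly hom g) x = (\<Sum>k<n. hom (coeff g k) * x ^ k)"
proof -
  have "poly (map_poly hom g) x = (\<Sum>k\<le>degree g. hom (coeff g k) * x ^ k)"
    unfolding poly_altdef
    by (rule sum.mono_neutral_cong_left) (auto simp: degree_map_poly_le intro!: le_degree)
  also have "\<dots> = (\<Sum>k<n. hom (coeff g k) * x ^ k)"
    by (rule sum.mono_neutral_left) (use assms in \<open>auto simp: coeff_eq_0\<close>)
  finally show ?thesis .
qed

lemma (in comm_ring_hom) poly_map_poly_ring: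
  "poly (map_poly hom (f + g)) x = poly (map_poly hom f) x + poly (map_poly hom g) x"
  "poly (map_poly hom (f - g)) x = poly (map_poly hom f) x - poly (map_poly hom g) x"
  "poly (map_poly hom (f * g)) x = poly (map_poly hom f) x * poly (map_poly hom g) x"
proof -
  interpret m: map_poly_comm_ring_hom hom ..
  show "poly (map_poly hom (f + g)) x = poly (map_poly hom f) x + poly (map_poly hom g) x"
    "poly (map_poly hom (f - g)) x = poly (map_poly hom f) x - poly (map_poly hom g) x"
    "poly (map_poly hom (f * g)) x = poly (map_poly hom f) x * poly (map_poly hom g) x"
    by (simp_all add: m.hom_add m.hom_minus m.hom_mult)
qed

section \<open>Separable polynomials over a separably closed field\<close>

text \<open>By division with remainder, a nonzero combination of least degree divides every
  combination, hence is a unit. The identity serves to carry coprimality through a field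
  homomorphism.\<close>

lemma poly_bezout:
  fixes f g :: "'a::field poly"
  assumes "coprime f g"
  obtains a b where "a * f + b * g = 1"
proof -
  let ?S = "{d. d \<noteq> 0 \<and> (\<exists>a b. d = a * f + b * g)}"
  have "f \<noteq> 0 \<or> g \<noteq> 0" using assms by auto
  moreover have "f = 1 * f + 0 * g" "g = 0 * f + 1 * g" by simp_all
  ultimately have "\<exists>d. d \<in> ?S" by blast
  then obtain d where d: "d \<in> ?S" and min: "\<And>e. e \<in> ?S \<Longrightarrow> degree d \<le> degree e"
    using ex_has_least_nat[of "\<lambda>d. d \<in> ?S" _ degree] by blast
  then obtain a b where ab: "d = a * f + b * g" by blast
  have dvd: "d dvd r" if r: "r = s * f + t * g" for r s t
  proof (rule ccontr)
    assume "\<not> d dvd r"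
    then have nz: "r mod d \<noteq> 0" by (simp add: mod_eq_0_iff_dvd)
    have "r mod d = r - r div d * d" by (simp add: minus_div_mult_eq_mod)
    also have "\<dots> = (s - r div d * a) * f + (t - r div d * b) * g"
      by (simp add: r ab algebra_simps)
    finally have "r mod d \<in> ?S" using nz by blast
    from min[OF this] d nz degree_mod_less[of d r] show False by auto
  qed
  have "d dvd f" "d dvd g" using dvd[of f 1 0] dvd[of g 0 1] by simp_all
  with assms have "d dvd 1" by (rule coprime_common_divisor)
  then obtain e where e: "1 = d * e" ..
  have "e * a * f + e * b * g = 1" unfolding e ab by (simp add: algebra_simps)
  with that show thesis .
qed

lemma separable_poly_factor:
  assumes "separable_poly (f * g)"
  shows "separable_poly g"
  unfolding separable_poly_def
proof (rule coprimeI)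
  fix d assume "d dvd g" "d dvd pderiv g"
  then have "d dvd f * g" "d dvd pderiv (f * g)" by (simp_all add: pderiv_mult)
  with assms show "is_unit d" unfolding separable_poly_def by (rule coprime_common_divisor)
qed

text \<open>Induction on the degree: the cofactor of a root is again separable, and a repeated root
  would be a common root of \<open>g\<close> and its derivative.\<close>

lemma separable_poly_splits:
  fixes g :: "'s::field poly"
  assumes root: "\<And>f :: 's poly. separable_poly f \<Longrightarrow> 0 < degree f \<Longrightarrow> \<exists>x. poly f x = 0"
  shows "separable_poly g \<Longrightarrow> lead_coeff g = 1 \<Longrightarrow>
    finite {x. poly g x = 0} \<and> card {x. poly g x = 0} = degree g"
proof (induction "degree g" arbitrary: g)
  case 0
  then obtain c where "g = [:c:]" by (metis degree_eq_zeroE)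
  with 0 have "g = 1" by (simp add: one_pCons)
  then show ?case by simp
next
  case (Suc d)
  then obtain x where x: "poly g x = 0" using root[of g] by auto
  then obtain g1 where g: "g = [:- x, 1:] * g1" unfolding poly_eq_0_iff_dvd by blast
  have "g1 \<noteq> 0" using Suc g by auto
  have deg: "degree g = Suc (degree g1)" unfolding g using \<open>g1 \<noteq> 0\<close> by (subst degree_mult_eq) simp_all
  have lead: "lead_coeff g1 = 1" using Suc.prems(2) unfolding g lead_coeff_mult by simp
  have IH: "finite {x. poly g1 x = 0} \<and> card {x. poly g1 x = 0} = degree g1"
    using Suc deg lead separable_poly_factor[of "[:- x, 1:]" g1] g by auto
  have "poly g1 x \<noteq> 0"
  proof
    assume "poly g1 x = 0"
    then have "[:- x, 1:] dvd g1" by (simp add: poly_eq_0_iff_dvd)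
    then have "[:- x, 1:] dvd g" "[:- x, 1:] dvd pderiv g"
      unfolding g by (simp_all only: pderiv_mult dvd_add dvd_mult dvd_mult2 dvd_triv_left)
    with Suc.prems(1) have "is_unit [:- x, 1:]" unfolding separable_poly_def by (rule coprime_common_divisor)
    then show False by (auto simp: is_unit_poly_iff)
  qed
  moreover have "{x. poly g x = 0} = insert x {x. poly g1 x = 0}" unfolding g by auto
  ultimately show ?case using IH deg by simp
qed

section \<open>Power basis, Eisenstein polynomial and embeddings\<close>

context totally_ramified_ext
begin

text \<open>The first \<open>n\<close> powers of the uniformizer are independent, and their number
  equals the dimension.\<close>

lemma powers_span:
  assumes deg: "n = ext_degree \<iota>"
  obtains b where "\<alpha> = (\<Sum>k<n. \<iota> (b k) * \<pi> ^ k)"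
proof -
  interpret V: vector_space "\<lambda>c x. \<iota> c * x"
    by unfold_locales (simp_all add: algebra_simps hom_add hom_mult)
  have dim: "V.dim UNIV = n" using deg unfolding ext_degree_def by simp
  obtain B where B: "V.independent B" "UNIV \<subseteq> V.span B"
    using V.maximal_independent_subset[of UNIV] by blast
  then have card_B: "card B = n" using V.basis_card_eq_dim[of B UNIV] dim by simp
  \<comment> \<open>Infinite sets have cardinality \<open>0\<close>, so \<open>n > 0\<close> forces
    the basis to be finite.\<close>
  then have fin: "finite B" using card_B n_pos by (auto intro: card_ge_0_finite)
  interpret F: finite_dimensional_vector_space "\<lambda>c x. \<iota> c * x" B
    by unfold_locales (use B fin in auto)
  let ?P = "(\<lambda>k. \<pi> ^ k) ` {..<n}"
  have inj: "inj_on (\<lambda>k. \<pi> ^ k) {..<n}"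
  proof (rule inj_onI)
    fix k l assume "\<pi> ^ k = \<pi> ^ l"
    then have "vL (\<pi> ^ k) = vL (\<pi> ^ l)" by simp
    then show "k = l" by (simp add: L.v_power vL_\<pi>)
  qed
  have "V.independent ?P"
  proof (rule V.independent_if_scalars_zero)
    fix f x assume "(\<Sum>x\<in>?P. \<iota> (f x) * x) = 0" "x \<in> ?P"
    then show "f x = 0"
      using combination_zero[of "\<lambda>k. f (\<pi> ^ k)"] by (auto simp: sum.reindex[OF inj])
  qed simp
  then have "UNIV \<subseteq> V.span ?P"
    by (intro F.card_ge_dim_independent) (simp_all add: card_B card_image[OF inj])
  then have "\<alpha> \<in> V.span ?P" by blast
  then obtain u where "\<alpha> = (\<Sum>x\<in>?P. \<iota> (u x) * x)"
    unfolding V.span_finite[OF finite_imageI[OF finite_lessThan]] by blast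
  then have "\<alpha> = (\<Sum>k<n. \<iota> (u (\<pi> ^ k)) * \<pi> ^ k)" by (simp add: sum.reindex[OF inj])
  with that show thesis .
qed

text \<open>Writing the \<open>n\<close>-th power of the uniformizer in the power basis gives a
  monic polynomial of degree \<open>n\<close>. Independence of the lower powers excludes smaller
  degrees, which resolves the \<open>THE\<close> in \<open>min_poly\<close>.\<close>

lemma min_poly_unif:
  assumes deg: "n = ext_degree \<iota>"
  shows "lead_coeff (min_poly \<iota> \<pi>) = 1" "degree (min_poly \<iota> \<pi>) = n"
    "poly (map_poly \<iota> g) \<pi> = 0 \<longleftrightarrow> min_poly \<iota> \<pi> dvd g"
proof -
  obtain b where b: "\<pi> ^ n = (\<Sum>k<n. \<iota> (b k) * \<pi> ^ k)"
    using powers_span[OF deg] .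
  define f where "f = monom 1 n - (\<Sum>k<n. monom (b k) k)"
  have coeff_f: "coeff f k = (if k = n then 1 else if k < n then - b k else 0)" for k
    unfolding f_def by (simp add: coeff_sum)
  have deg_f: "degree f = n"
    by (intro antisym degree_le le_degree) (auto simp: coeff_f)
  have lead_f: "lead_coeff f = 1" by (simp add: deg_f coeff_f)
  have "poly (map_poly \<iota> f) \<pi> = (\<Sum>k<Suc n. \<iota> (coeff f k) * \<pi> ^ k)"
    by (rule poly_map_poly_sum) (simp add: deg_f)
  also have "\<dots> = 0" by (simp add: coeff_f b hom_uminus sum_negf)
  finally have root_f: "poly (map_poly \<iota> f) \<pi> = 0" .
  have minimal: "g = 0" if "poly (map_poly \<iota> g) \<pi> = 0" "degree g < n" for g
  proof (rule poly_eqI)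
    fix k
    show "coeff g k = coeff 0 k"
      using combination_zero[of "coeff g" k] that poly_map_poly_sum[OF that(2), of \<pi>]
      by (cases "k < n") (simp_all add: coeff_eq_0)
  qed
  have "min_poly \<iota> \<pi> = f"
    unfolding min_poly_def
  proof (rule the_equality)
    have "degree f \<le> degree g" if "g \<noteq> 0" "poly (map_poly \<iota> g) \<pi> = 0" for g
      using minimal[OF that(2)] that(1) by (auto simp: deg_f not_less[symmetric])
    with lead_f root_f show "lead_coeff f = 1 \<and> poly (map_poly \<iota> f) \<pi> = 0 \<and>
        (\<forall>g. g \<noteq> 0 \<and> poly (map_poly \<iota> g) \<pi> = 0 \<longrightarrow> degree f \<le> degree g)"
      by blast
  next
    fix g
    assume g: "lead_coeff g = 1 \<and> poly (map_poly \<iota> g) \<pi> = 0 \<and>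
        (\<forall>g'. g' \<noteq> 0 \<and> poly (map_poly \<iota> g') \<pi> = 0 \<longrightarrow> degree g \<le> degree g')"
    have "f \<noteq> 0" using lead_f by auto
    with g root_f have "degree g \<le> n" unfolding deg_f[symmetric] by blast
    moreover have "\<not> degree g < n" using minimal[of g] g by auto
    ultimately have deg_g: "degree g = n" by simp
    have "g - f = 0"
    proof (rule minimal)
      show "poly (map_poly \<iota> (g - f)) \<pi> = 0"
        using g root_f by (simp add: poly_map_poly_ring)
      have "degree (g - f) \<le> n" by (rule degree_diff_le) (simp_all add: deg_f deg_g)
      moreover have "degree (g - f) \<noteq> n"
      proof
        assume n: "degree (g - f) = n"
        moreover have "coeff (g - f) n = 0" using g lead_f by (simp add: deg_f deg_g)
        ultimately have "g - f = 0" by (metis leading_coeff_0_iff)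
        with n n_pos show False by simp
      qed
      ultimately show "degree (g - f) < n" by simp
    qed
    then show "g = f" by simp
  qed
  moreover have "poly (map_poly \<iota> g) \<pi> = 0 \<longleftrightarrow> f dvd g"
  proof
    assume "f dvd g"
    then obtain r where "g = f * r" ..
    then show "poly (map_poly \<iota> g) \<pi> = 0" by (simp add: poly_map_poly_ring root_f)
  next
    assume g: "poly (map_poly \<iota> g) \<pi> = 0"
    have "poly (map_poly \<iota> (g div f * f + g mod f)) \<pi> = poly (map_poly \<iota> (g mod f)) \<pi>"
      unfolding poly_map_poly_ring by (simp add: root_f)
    with g have "poly (map_poly \<iota> (g mod f)) \<pi> = 0" by simp
    moreover have "degree (g mod f) < n"
      using degree_mod_less[of f g] lead_f n_pos deg_f by force
    ultimately have "g mod f = 0" by (rule minimal)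
    then show "f dvd g" by (simp add: mod_eq_0_iff_dvd)
  qed
  ultimately show "lead_coeff (min_poly \<iota> \<pi>) = 1" "degree (min_poly \<iota> \<pi>) = n"
    "poly (map_poly \<iota> g) \<pi> = 0 \<longleftrightarrow> min_poly \<iota> \<pi> dvd g"
    using lead_f deg_f by simp_all
qed

text \<open>The terms below degree \<open>n\<close> add up to a sum of value \<open>n\<close>, so
  each has value at least \<open>n\<close>. For \<open>0 < a < n\<close> equality is impossible
  modulo \<open>n\<close>, so the constant term must attain it.\<close>

lemma eisenstein:
  assumes deg: "n = ext_degree \<iota>"
  shows "a < n \<Longrightarrow> ereal (real n) \<le> ereal (real n) * vK (coeff (min_poly \<iota> \<pi>) a) + ereal (real a)"
    and "ereal (real n) * vK (coeff (min_poly \<iota> \<pi>) 0) \<le> ereal (real n)"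
proof -
  let ?f = "min_poly \<iota> \<pi>"
  note f = min_poly_unif[OF deg]
  have "poly (map_poly \<iota> ?f) \<pi> = (\<Sum>k<Suc n. \<iota> (coeff ?f k) * \<pi> ^ k)"
    by (rule poly_map_poly_sum) (simp add: f(2))
  moreover have "poly (map_poly \<iota> ?f) \<pi> = 0" using f(3) by simp
  moreover have "coeff ?f n = 1" using f(1,2) by simp
  ultimately have "(\<Sum>k<n. \<iota> (coeff ?f k) * \<pi> ^ k) + \<pi> ^ n = 0" by simp
  then have "(\<Sum>k<n. \<iota> (coeff ?f k) * \<pi> ^ k) = - (\<pi> ^ n)" by (simp add: eq_neg_iff_add_eq_0)
  then have val: "vL (\<Sum>k<n. \<iota> (coeff ?f k) * \<pi> ^ k) = ereal (real n)"
    by (simp add: L.v_power vL_\<pi>)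
  show le: "ereal (real n) \<le> ereal (real n) * vK (coeff ?f a) + ereal (real a)" if "a < n" for a
    using vL_combination_le[OF that, of "coeff ?f"] unfolding val .
  show "ereal (real n) * vK (coeff ?f 0) \<le> ereal (real n)"
  proof (rule ccontr)
    assume gt: "\<not> ?thesis"
    have "ereal (real n) < vL (\<iota> (coeff ?f a) * \<pi> ^ a)" if a: "a \<in> {..<n}" for a
    proof (cases "a = 0")
      case True
      then show ?thesis using gt by (simp add: vL_\<iota> not_le)
    next
      case False
      show ?thesis
      proof (cases "coeff ?f a = 0")
        case False
        then obtain c where c: "vK (coeff ?f a) = ereal (of_int c)" by (rule K.v_int)
        have "real n \<noteq> real n * of_int c + real a"
        proof
          assume "real n = real n * of_int c + real a"
          then have "real_of_int (int n) = real_of_int (int n * c + int a)" by simp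
          then have "int n = int n * c + int a" by (simp only: of_int_eq_iff)
          then have "int n mod int n = (int n * c + int a) mod int n" by simp
          with a \<open>a \<noteq> 0\<close> show False by simp
        qed
        with le[of a] a show ?thesis by (simp add: vL_monomial c less_le)
      qed simp
    qed
    then have "ereal (real n) < vL (\<Sum>k<n. \<iota> (coeff ?f k) * \<pi> ^ k)"
      by (intro L.v_sum_less) auto
    with val show False by simp
  qed
qed

text \<open>Every element of \<open>L\<close> is a polynomial in the uniformizer, so an embedding is
  determined by one value; conversely a root defines an embedding by substitution.\<close>

lemma bij_embeddings_roots:
  fixes \<tau> :: "'l \<Rightarrow> 's::field"
  assumes deg: "n = ext_degree \<iota>" and \<tau>: "field_hom \<tau>"
  shows "bij_betw (\<lambda>\<sigma>. \<sigma> \<pi>) (embeddings \<iota> \<tau>) {x. poly (map_poly (\<tau> \<circ> \<iota>) (min_poly \<iota> \<pi>)) x = 0}"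
proof (rule bij_betw_imageI)
  let ?f = "min_poly \<iota> \<pi>"
  note f = min_poly_unif[OF deg]
  interpret \<tau>: field_hom \<tau> by fact
  interpret \<tau>\<iota>: field_hom "\<tau> \<circ> \<iota>" by unfold_locales (simp_all add: \<tau>.hom_add \<tau>.hom_mult hom_add hom_mult)
  have \<sigma>_poly: "\<sigma> (poly (map_poly \<iota> g) \<pi>) = poly (map_poly (\<tau> \<circ> \<iota>) g) (\<sigma> \<pi>)"
    if "\<sigma> \<in> embeddings \<iota> \<tau>" for \<sigma> g
  proof -
    interpret \<sigma>: field_hom \<sigma> using that by (simp add: embeddings_def)
    have "map_poly \<sigma> (map_poly \<iota> g) = map_poly (\<tau> \<circ> \<iota>) g"
      using that by (simp add: map_poly_map_poly embeddings_def)
    then show ?thesis by (metis \<sigma>.poly_map_poly)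
  qed
  have surj: "\<exists>g. \<alpha> = poly (map_poly \<iota> g) \<pi>" for \<alpha>
  proof -
    obtain b where "\<alpha> = (\<Sum>k<n. \<iota> (b k) * \<pi> ^ k)" using powers_span[OF deg] .
    moreover have "poly (map_poly \<iota> (\<Sum>k<N. monom (b k) k)) \<pi> = (\<Sum>k<N. \<iota> (b k) * \<pi> ^ k)" for N
      by (induction N) (simp_all add: poly_map_poly_ring poly_monom)
    ultimately have "\<alpha> = poly (map_poly \<iota> (\<Sum>k<n. monom (b k) k)) \<pi>" by simp
    then show ?thesis ..
  qed
  show "inj_on (\<lambda>\<sigma>. \<sigma> \<pi>) (embeddings \<iota> \<tau>)"
  proof (rule inj_onI, rule ext)
    fix \<sigma> \<sigma>' \<alpha> assume "\<sigma> \<in> embeddings \<iota> \<tau>" "\<sigma>' \<in> embeddings \<iota> \<tau>" "\<sigma> \<pi> = \<sigma>' \<pi>"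
    then show "\<sigma> \<alpha> = \<sigma>' \<alpha>" using surj[of \<alpha>] by (auto simp: \<sigma>_poly)
  qed
  show "(\<lambda>\<sigma>. \<sigma> \<pi>) ` embeddings \<iota> \<tau> = {x. poly (map_poly (\<tau> \<circ> \<iota>) ?f) x = 0}"
  proof (intro equalityI subsetI)
    fix x assume "x \<in> (\<lambda>\<sigma>. \<sigma> \<pi>) ` embeddings \<iota> \<tau>"
    then obtain \<sigma> where \<sigma>: "\<sigma> \<in> embeddings \<iota> \<tau>" "x = \<sigma> \<pi>" by blast
    have "poly (map_poly \<iota> ?f) \<pi> = 0" using f(3) by simp
    then have "poly (map_poly (\<tau> \<circ> \<iota>) ?f) (\<sigma> \<pi>) = \<sigma> 0" using \<sigma>_poly[OF \<sigma>(1), of ?f] by simp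
    moreover have "\<sigma> 0 = 0"
    proof -
      interpret \<sigma>: field_hom \<sigma> using \<sigma>(1) by (simp add: embeddings_def)
      show ?thesis by simp
    qed
    ultimately show "x \<in> {x. poly (map_poly (\<tau> \<circ> \<iota>) ?f) x = 0}" using \<sigma>(2) by simp
  next
    fix x assume x: "x \<in> {x. poly (map_poly (\<tau> \<circ> \<iota>) ?f) x = 0}"
    define rep where "rep \<alpha> = (SOME g. \<alpha> = poly (map_poly \<iota> g) \<pi>)" for \<alpha>
    define \<sigma> where "\<sigma> \<alpha> = poly (map_poly (\<tau> \<circ> \<iota>) (rep \<alpha>)) x" for \<alpha>
    have rep: "poly (map_poly \<iota> (rep \<alpha>)) \<pi> = \<alpha>" for \<alpha>
      unfolding rep_def using someI_ex[OF surj[of \<alpha>]] by simp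
    \<comment> \<open>Independence of the chosen representative: two of them differ by a multiple of
      the minimal polynomial, which vanishes at \<open>x\<close>.\<close>
    have \<sigma>: "\<sigma> (poly (map_poly \<iota> g) \<pi>) = poly (map_poly (\<tau> \<circ> \<iota>) g) x" for g
    proof -
      have "poly (map_poly \<iota> (rep (poly (map_poly \<iota> g) \<pi>) - g)) \<pi> = 0"
        unfolding poly_map_poly_ring by (simp add: rep)
      then obtain r where r: "rep (poly (map_poly \<iota> g) \<pi>) - g = ?f * r" unfolding f(3) ..
      have "poly (map_poly (\<tau> \<circ> \<iota>) (rep (poly (map_poly \<iota> g) \<pi>) - g)) x = 0"
        unfolding r \<tau>\<iota>.poly_map_poly_ring using x by simp
      then show ?thesis unfolding \<tau>\<iota>.poly_map_poly_ring \<sigma>_def by simp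
    qed
    have "field_hom \<sigma>"
    proof
      have "\<sigma> (poly (map_poly \<iota> 0) \<pi>) = 0" unfolding \<sigma> by simp
      then show "\<sigma> 0 = 0" by simp
      have "\<sigma> (poly (map_poly \<iota> 1) \<pi>) = 1" unfolding \<sigma> by simp
      then show "\<sigma> 1 = 1" by simp
      fix \<alpha> \<beta>
      have "\<sigma> (poly (map_poly \<iota> (rep \<alpha> + rep \<beta>)) \<pi>) = \<sigma> \<alpha> + \<sigma> \<beta>"
        unfolding \<sigma> \<tau>\<iota>.poly_map_poly_ring by (simp add: \<sigma>_def)
      then show "\<sigma> (\<alpha> + \<beta>) = \<sigma> \<alpha> + \<sigma> \<beta>" by (simp add: poly_map_poly_ring rep)
      have "\<sigma> (poly (map_poly \<iota> (rep \<alpha> * rep \<beta>)) \<pi>) = \<sigma> \<alpha> * \<sigma> \<beta>"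
        unfolding \<sigma> \<tau>\<iota>.poly_map_poly_ring by (simp add: \<sigma>_def)
      then show "\<sigma> (\<alpha> * \<beta>) = \<sigma> \<alpha> * \<sigma> \<beta>" by (simp add: poly_map_poly_ring rep)
    qed
    moreover have "\<sigma> \<circ> \<iota> = \<tau> \<circ> \<iota>"
    proof
      fix c show "(\<sigma> \<circ> \<iota>) c = (\<tau> \<circ> \<iota>) c"
        using \<sigma>[of "[:c:]"] by (simp add: \<tau>\<iota>.map_poly_pCons_hom map_poly_pCons_hom)
    qed
    moreover have "\<sigma> \<pi> = x"
      using \<sigma>[of "[:0, 1:]"] by (simp add: \<tau>\<iota>.map_poly_pCons_hom map_poly_pCons_hom)
    ultimately show "x \<in> (\<lambda>\<sigma>. \<sigma> \<pi>) ` embeddings \<iota> \<tau>"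
      unfolding embeddings_def by blast
  qed
qed

text \<open>Separability gives a Bezout identity over \<open>K\<close>, which survives the passage
  to the separable closure; there the polynomial has as many roots as its degree.\<close>

lemma card_roots_min_poly:
  fixes \<tau> :: "'l \<Rightarrow> 's::field"
  assumes deg: "n = ext_degree \<iota>" and \<tau>: "field_hom \<tau>" and sep: "separable_closure (\<tau> \<circ> \<iota>)"
  shows "finite {x. poly (map_poly (\<tau> \<circ> \<iota>) (min_poly \<iota> \<pi>)) x = 0}"
    and "card {x. poly (map_poly (\<tau> \<circ> \<iota>) (min_poly \<iota> \<pi>)) x = 0} = n"
proof -
  let ?f = "min_poly \<iota> \<pi>"
  note f = min_poly_unif[OF deg]
  interpret \<tau>: field_hom \<tau> by fact
  interpret \<tau>\<iota>: field_hom "\<tau> \<circ> \<iota>" by unfold_locales (simp_all add: \<tau>.hom_add \<tau>.hom_mult hom_add hom_mult)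
  \<comment> \<open>As \<open>\<tau>\<close> is injective, the same polynomials vanish at the
    uniformizer and at its image, so the two minimal polynomials agree.\<close>
  have "poly (map_poly (\<tau> \<circ> \<iota>) g) (\<tau> \<pi>) = \<tau> (poly (map_poly \<iota> g) \<pi>)" for g
    using \<tau>.poly_map_poly[of "map_poly \<iota> g" \<pi>] by (simp add: map_poly_map_poly)
  then have "min_poly (\<tau> \<circ> \<iota>) (\<tau> \<pi>) = ?f" unfolding min_poly_def by simp
  moreover have "separable_element (\<tau> \<circ> \<iota>) (\<tau> \<pi>)" using sep unfolding separable_closure_def by blast
  ultimately have "coprime ?f (pderiv ?f)"
    unfolding separable_element_def separable_poly_def by simp
  then obtain a b where ab: "a * ?f + b * pderiv ?f = 1" by (rule poly_bezout)
  let ?m = "map_poly (\<tau> \<circ> \<iota>)"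
  interpret m: map_poly_comm_ring_hom "\<tau> \<circ> \<iota>" ..
  have "?m (a * ?f + b * pderiv ?f) = ?m 1" by (simp only: ab)
  then have ab': "?m a * ?m ?f + ?m b * pderiv (?m ?f) = 1"
    by (simp add: m.hom_add m.hom_mult \<tau>\<iota>.map_poly_pderiv)
  have "separable_poly (?m ?f)"
    unfolding separable_poly_def
  proof (rule coprimeI)
    fix d assume "d dvd ?m ?f" "d dvd pderiv (?m ?f)"
    then have "d dvd ?m a * ?m ?f + ?m b * pderiv (?m ?f)" by simp
    then show "is_unit d" unfolding ab' .
  qed
  moreover have "lead_coeff (?m ?f) = 1" using f(1) by simp
  ultimately have "finite {x. poly (?m ?f) x = 0} \<and> card {x. poly (?m ?f) x = 0} = degree (?m ?f)"
    using sep unfolding separable_closure_def by (intro separable_poly_splits) blast+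
  then show "finite {x. poly (?m ?f) x = 0}" "card {x. poly (?m ?f) x = 0} = n"
    using f(2) by simp_all
qed

end

subsection \<open>Indices of inseparability\<close>

text \<open>Products of linear factors reindex directly; comparing coefficients by Vieta's formula
  avoids reindexing a sum over subsets.\<close>

lemma elem_sym_reindex:
  fixes w :: "'i \<Rightarrow> 'a::comm_ring_1"
  assumes bij: "bij_betw e I J" and I: "finite I" and h: "h \<le> card I"
  shows "elem_sym h J w = elem_sym h I (\<lambda>i. w (e i))"
proof -
  have J: "finite J" "card J = card I"
    using bij I by (simp_all add: bij_betw_finite bij_betw_same_card)
  have "(\<Prod>i\<in>J. [:- w i, 1:]) = (\<Prod>i\<in>I. [:- w (e i), 1:])"
    by (rule prod.reindex_bij_betw[OF bij, symmetric])
  then have "(-1) ^ h * elem_sym h J w = (-1) ^ h * elem_sym h I (\<lambda>i. w (e i))"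
    using coeff_prod_linear_factors[OF I h, of "\<lambda>i. w (e i)"]
      coeff_prod_linear_factors[OF J(1), of h w] h J(2) by simp
  then have "(-1) ^ h * ((-1) ^ h * elem_sym h J w) = (-1) ^ h * ((-1) ^ h * elem_sym h I (\<lambda>i. w (e i)))"
    by simp
  then show ?thesis by (simp flip: mult.assoc power_mult_distrib)
qed

lemma elem_sym_scale: "elem_sym h I (\<lambda>i. c * w i) = c ^ h * elem_sym h I w"
  unfolding elem_sym_def sum_distrib_left
  by (rule sum.cong) (auto simp: prod.distrib)

text \<open>The factor \<open>h\<close> absorbs at most \<open>multiplicity p h\<close> of the
  \<open>t\<close> powers of \<open>p\<close>; truncated subtraction covers the case where it could
  absorb them all.\<close>

lemma prime_power_dvd_of_dvd_mult:
  fixes d :: int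
  assumes p: "prime p" and h: "0 < h" and dvd: "int (p ^ t) dvd int h * d"
  shows "int p ^ (t - multiplicity p h) dvd d"
proof (cases "multiplicity p h \<le> t")
  case True
  obtain k where k: "h = p ^ multiplicity p h * k" and nd: "\<not> p dvd k"
    using multiplicity_decompose'[of h p] h p by (metis not_prime_unit not_gr_zero)
  let ?j = "multiplicity p h"
  have "int p ^ ?j * int p ^ (t - ?j) dvd int p ^ ?j * (int k * d)"
    using dvd True by (subst (asm) k) (simp add: mult.assoc flip: power_add)
  then have "int p ^ (t - ?j) dvd int k * d"
    using p by (simp add: prime_gt_0_nat)
  moreover have "coprime (int p ^ (t - ?j)) (int k)"
  proof -
    have "coprime p k" using p nd by (rule prime_imp_coprime)
    then have "coprime (int p) (int k)" by simp
    then show ?thesis by simp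
  qed
  ultimately show ?thesis by (simp add: coprime_dvd_mult_right_iff)
qed simp

section \<open>Value bounds for the universal polynomial\<close>

context totally_ramified_ext
begin

text \<open>The Eisenstein bound in degree \<open>n - k\<close>: dividing \<open>c_k\<close> by the
  \<open>k\<close>-th power of the uniformizer leaves an integral element.\<close>

lemma min_poly_coeff_nonneg:
  assumes deg: "n = ext_degree \<iota>" and k: "k \<in> {1..n}"
  shows "0 \<le> ereal (real n) * vK (min_poly_coeff \<iota> \<pi> k) - ereal (real k)"
proof -
  have "vK (min_poly_coeff \<iota> \<pi> k) = vK (coeff (min_poly \<iota> \<pi>) (n - k))"
    unfolding min_poly_coeff_def deg[symmetric] by (cases "even k") simp_all
  moreover have "ereal (real n) \<le> ereal (real n) * vK (coeff (min_poly \<iota> \<pi>) (n - k)) + ereal (real (n - k))"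
    by (rule eisenstein(1)[OF deg]) (use k in simp)
  ultimately show ?thesis
    using k by (cases "vK (coeff (min_poly \<iota> \<pi>) (n - k))") (auto simp: of_nat_diff)
qed

lemma insep_index_unif_le:
  assumes "n = ext_degree \<iota>" "k \<in> {1..n}" "trunc_val p \<nu> k \<le> t"
  shows "insep_index_unif vK \<iota> p \<nu> \<pi> t \<le> ereal (real n) * vK (min_poly_coeff \<iota> \<pi> k) - ereal (real k)"
  unfolding insep_index_unif_def assms(1)[symmetric]
  by (rule Min_le) (use assms(2,3) in auto)

lemma insep_index_unif_ge:
  assumes "n = ext_degree \<iota>"
    and "\<And>k. k \<in> {1..n} \<Longrightarrow> trunc_val p \<nu> k \<le> t \<Longrightarrow>
      c \<le> ereal (real n) * vK (min_poly_coeff \<iota> \<pi> k) - ereal (real k)"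
  shows "c \<le> insep_index_unif vK \<iota> p \<nu> \<pi> t"
proof -
  \<comment> \<open>The index \<open>1\<close> has truncated valuation \<open>0\<close>, so the
    minimum is over a nonempty set.\<close>
  have "1 \<in> {k \<in> {1..n}. trunc_val p \<nu> k \<le> t}" using n_pos by (simp add: trunc_val_def)
  then show ?thesis
    unfolding insep_index_unif_def assms(1)[symmetric] by (subst Min_ge_iff) (use assms(2) in auto)
qed

lemma insep_index_le:
  assumes "t \<in> {j..\<nu>}"
  shows "insep_index vK vL \<iota> p \<nu> \<pi> j \<le> insep_index_unif vK \<iota> p \<nu> \<pi> t + ereal (real (t - j)) * vL (of_nat p)"
  unfolding insep_index_def by (rule Min_le) (use assms in auto)

lemma insep_index_nonneg:
  assumes deg: "n = ext_degree \<iota>" and j: "j \<le> \<nu>"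
  shows "0 \<le> insep_index vK vL \<iota> p \<nu> \<pi> j"
proof -
  have "0 \<le> insep_index_unif vK \<iota> p \<nu> \<pi> t" for t
    by (rule insep_index_unif_ge[OF deg]) (rule min_poly_coeff_nonneg[OF deg])
  then show ?thesis
    unfolding insep_index_def using j L.v_of_nat_nonneg by (subst Min_ge_iff) auto
qed

text \<open>With \<open>t\<close> the least truncated valuation occurring in a monomial of \<open>univ_esym\<close>, the coefficient is
  divisible by \<open>p\<^sup>t\<^sup>-\<^sup>j\<close> and the monomial has value at least \<open>i\<^sub>t\<close> computed from \<open>\<pi>\<close>.\<close>

lemma vL_univ_esym_ge:
  assumes deg: "n = ext_degree \<iota>" and p: "prime p" and n: "n = u * p ^ \<nu>"
    and h: "1 \<le> h" "h \<le> n" and j: "j = min (multiplicity p h) \<nu>"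
    and nonneg: "\<And>i. 0 \<le> vL (\<phi> i)"
    and \<phi>: "\<And>a. a < n \<Longrightarrow>
      vL (\<phi> a) = ereal (real n) * vK (min_poly_coeff \<iota> \<pi> (n - a)) - ereal (real (n - a))"
  shows "insep_index vK vL \<iota> p \<nu> \<pi> j \<le> vL (mpoly_eval \<phi> (univ_esym n h))"
  unfolding mpoly_eval_def
proof (rule L.v_sum)
  fix m
  let ?d = "Poly_Mapping.lookup (univ_esym n h) m"
  let ?U = "insep_index_unif vK \<iota> p \<nu> \<pi>"
  \<comment> \<open>Inserting \<open>\<nu>\<close> gives \<open>t\<close> a value, namely
    \<open>\<nu>\<close>, for monomials without variables below \<open>n\<close>.\<close>
  define T where "T = insert \<nu> ((\<lambda>a. trunc_val p \<nu> (n - a)) ` {a \<in> Poly_Mapping.keys m. a < n})"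
  define t where "t = Min T"
  have finT: "finite T" unfolding T_def by simp
  have t_le: "t \<le> trunc_val p \<nu> (n - a)" if "a \<in> Poly_Mapping.keys m" "a < n" for a
    unfolding t_def by (rule Min_le[OF finT]) (use that in \<open>auto simp: T_def\<close>)
  have t_\<nu>: "t \<le> \<nu>" unfolding t_def by (rule Min_le[OF finT]) (simp add: T_def)
  have "t \<in> T" unfolding t_def by (rule Min_in[OF finT]) (simp add: T_def)
  have pow_nonneg: "0 \<le> vL (\<phi> i ^ k)" for i k
    using nonneg[of i] by (simp add: L.v_power)
  have monom: "?U t \<le> vL (monom_eval \<phi> m)"
  proof (cases "t = \<nu>")
    case True
    \<comment> \<open>For \<open>t = \<nu>\<close> the index \<open>n\<close> is admissible, and the
      Eisenstein constant term makes \<open>?U t\<close> at most \<open>0\<close>; integrality of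
      the monomial then suffices.\<close>
    have "vK (min_poly_coeff \<iota> \<pi> n) = vK (coeff (min_poly \<iota> \<pi>) 0)"
      unfolding min_poly_coeff_def deg[symmetric] by (cases "even n") simp_all
    then have "ereal (real n) * vK (min_poly_coeff \<iota> \<pi> n) - ereal (real n) \<le> 0"
      using eisenstein(2)[OF deg] n_pos by (cases "vK (coeff (min_poly \<iota> \<pi>) 0)") auto
    moreover have "?U t \<le> ereal (real n) * vK (min_poly_coeff \<iota> \<pi> n) - ereal (real n)"
      by (rule insep_index_unif_le[OF deg]) (use n_pos True in \<open>auto simp: trunc_val_def\<close>)
    ultimately have "?U t \<le> 0" by (rule order_trans[rotated])
    also have "0 \<le> vL (monom_eval \<phi> m)"
      unfolding monom_eval_def by (intro L.v_prod_nonneg pow_nonneg)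
    finally show ?thesis .
  next
    case False
    \<comment> \<open>A single variable attaining the minimum \<open>t\<close> already gives the
      bound, as all other factors are integral.\<close>
    then obtain a where a: "a \<in> Poly_Mapping.keys m" "a < n" and t: "t = trunc_val p \<nu> (n - a)"
      using \<open>t \<in> T\<close> by (auto simp: T_def)
    obtain k where k: "Poly_Mapping.lookup m a = Suc k"
      using a(1) by (auto simp: in_keys_iff gr0_conv_Suc)
    have "?U t \<le> vL (\<phi> a)"
      unfolding \<phi>[OF a(2)] by (rule insep_index_unif_le[OF deg]) (use a t in auto)
    also have "\<dots> \<le> vL (\<phi> a) + (vL (\<phi> a ^ k) +
        vL (\<Prod>i\<in>Poly_Mapping.keys m - {a}. \<phi> i ^ Poly_Mapping.lookup m i))"
      by (intro add_increasing2 order_refl add_nonneg_nonneg L.v_prod_nonneg pow_nonneg)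
    also have "\<dots> = vL (monom_eval \<phi> m)"
      unfolding monom_eval_def
      by (subst prod.remove[OF finite_keys a(1)]) (simp add: k L.v_mult add.assoc)
    finally show ?thesis .
  qed
  have "insep_index vK vL \<iota> p \<nu> \<pi> j \<le> vL (of_int ?d) + vL (monom_eval \<phi> m)"
  proof (cases "j \<le> t")
    case True
    have "int (p ^ t) dvd int h * ?d"
    proof (rule dvd_lookup_univ_esym)
      show pn: "p ^ t dvd n" unfolding n using t_\<nu> by (intro dvd_mult le_imp_power_dvd)
      fix a assume a: "a \<in> Poly_Mapping.keys m" "a < n"
      have pna: "p ^ t dvd n - a"
        by (rule multiplicity_dvd') (use t_le[OF a] in \<open>simp add: trunc_val_def\<close>)
      have "p ^ t dvd n - (n - a)" using pn pna by (rule dvd_diff_nat)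
      then show "p ^ t dvd a" using a by simp
    qed (rule h)
    then have "int p ^ (t - multiplicity p h) dvd ?d"
      using p h by (intro prime_power_dvd_of_dvd_mult) simp_all
    \<comment> \<open>If \<open>\<nu>\<close> truncates the multiplicity of \<open>h\<close>, both
      differences are \<open>0\<close> because \<open>t \<le> \<nu>\<close>.\<close>
    moreover have "t - j = t - multiplicity p h" using t_\<nu> unfolding j by simp
    ultimately have "ereal (real (t - j)) * vL (of_nat p) \<le> vL (of_int ?d)"
      by (intro L.v_of_int_dvd) simp
    then have "?U t + ereal (real (t - j)) * vL (of_nat p) \<le> vL (monom_eval \<phi> m) + vL (of_int ?d)"
      using monom by (rule add_mono[rotated])
    with insep_index_le[of t j \<nu> p] True t_\<nu> show ?thesis by (simp add: add.commute)
  next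
    case False
    \<comment> \<open>For \<open>t < j\<close> the coefficient contributes nothing: the minimum
      defining \<open>?U j\<close> runs over a larger set than that for \<open>?U t\<close>.\<close>
    have "insep_index vK vL \<iota> p \<nu> \<pi> j \<le> ?U j"
      using insep_index_le[of j j \<nu> p] j by (simp add: zero_ereal_def[symmetric])
    also have "\<dots> \<le> ?U t"
      by (rule insep_index_unif_ge[OF deg], rule insep_index_unif_le[OF deg]) (use False in auto)
    also have "\<dots> \<le> vL (monom_eval \<phi> m)" by (rule monom)
    finally show ?thesis using L.v_of_int_nonneg by (simp add: add_increasing)
  qed
  then show "insep_index vK vL \<iota> p \<nu> \<pi> j \<le> vL (of_int ?d * monom_eval \<phi> m)"
    by (simp add: L.v_mult)
qed

section \<open>Descent to the base field and rescaling\<close>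

text \<open>The universal polynomial evaluated at elements of \<open>K\<close> gives
  \<open>z\<close>, identified with \<open>E_h\<close> in the separable closure. Evaluated at
  rescaled arguments in \<open>L\<close> it gives \<open>z\<close> times a known power of the
  uniformizer, and there the value bound applies.\<close>

lemma E_map_descends:
  fixes \<tau> :: "'l \<Rightarrow> 's::field" and r :: int
  assumes deg: "n = ext_degree \<iota>" and \<tau>: "field_hom \<tau>" and sep: "separable_closure (\<tau> \<circ> \<iota>)"
    and p: "prime p" and n: "n = u * p ^ \<nu>"
    and h: "1 \<le> h" "h \<le> n" and j: "j = min (multiplicity p h) \<nu>"
    and \<alpha>: "ereal (of_int r) \<le> vL \<alpha>"
  obtains z where "E_map \<iota> \<tau> h \<alpha> = \<tau> (\<iota> z)"
    and "insep_index vK vL \<iota> p \<nu> \<pi> j + ereal (of_int (r * int h)) \<le> ereal (real n) * vK z"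
proof -
  let ?f = "min_poly \<iota> \<pi>"
  let ?R = "{x. poly (map_poly (\<tau> \<circ> \<iota>) ?f) x = 0}"
  note f = min_poly_unif[OF deg] and R = card_roots_min_poly[OF deg \<tau> sep]
  interpret \<tau>: field_hom \<tau> by fact
  interpret \<tau>\<iota>: field_hom "\<tau> \<circ> \<iota>" by unfold_locales (simp_all add: \<tau>.hom_add \<tau>.hom_mult hom_add hom_mult)
  obtain b where b: "\<alpha> = (\<Sum>i<n. \<iota> (b i) * \<pi> ^ i)" using powers_span[OF deg] .
  obtain x where x: "bij_betw x {..<n} ?R"
    using ex_bij_betw_nat_finite[OF R(1)] R(2) by (auto simp: atLeast0LessThan)
  have inj_x: "inj_on x {..<n}" using x by (rule bij_betw_imp_inj_on)
  have root: "x k ^ n + (\<Sum>a<n. \<tau> (\<iota> (coeff ?f a)) * x k ^ a) = 0" if "k < n" for k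
  proof -
    have "poly (map_poly (\<tau> \<circ> \<iota>) ?f) (x k) = 0" using x that by (auto dest: bij_betwE)
    moreover have "poly (map_poly (\<tau> \<circ> \<iota>) ?f) (x k) = (\<Sum>a<Suc n. (\<tau> \<circ> \<iota>) (coeff ?f a) * x k ^ a)"
      by (rule \<tau>\<iota>.poly_map_poly_sum) (simp add: f(2))
    moreover have "coeff ?f n = 1" using f(1,2) by simp
    ultimately show ?thesis by (simp add: add.commute)
  qed
  note bij = bij_embeddings_roots[OF deg \<tau>]
  have fin_emb: "finite (embeddings \<iota> \<tau>)" and card_emb: "card (embeddings \<iota> \<tau>) = n"
    using bij R by (simp_all add: bij_betw_finite bij_betw_same_card)
  have "E_map \<iota> \<tau> h \<alpha> = elem_sym h (embeddings \<iota> \<tau>) (\<lambda>\<sigma>. \<Sum>i<n. \<tau> (\<iota> (b i)) * \<sigma> \<pi> ^ i)"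
    unfolding E_map_def elem_sym_def
  proof (intro sum.cong prod.cong refl)
    fix S \<sigma> assume "S \<in> {S. S \<subseteq> embeddings \<iota> \<tau> \<and> card S = h}" "\<sigma> \<in> S"
    then have \<sigma>: "field_hom \<sigma>" "\<sigma> \<circ> \<iota> = \<tau> \<circ> \<iota>" by (auto simp: embeddings_def)
    interpret \<sigma>: field_hom \<sigma> by (rule \<sigma>(1))
    show "\<sigma> \<alpha> = (\<Sum>i<n. \<tau> (\<iota> (b i)) * \<sigma> \<pi> ^ i)"
      using \<sigma>(2) unfolding b by (simp add: \<sigma>.hom_sum \<sigma>.hom_mult \<sigma>.hom_power fun_eq_iff)
  qed
  also have "\<dots> = elem_sym h ?R (\<lambda>x. \<Sum>i<n. \<tau> (\<iota> (b i)) * x ^ i)"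
    using elem_sym_reindex[OF bij fin_emb, of h "\<lambda>x. \<Sum>i<n. \<tau> (\<iota> (b i)) * x ^ i"] h(2)
    by (simp add: card_emb)
  also have "\<dots> = elem_sym h {..<n} (\<lambda>k. \<Sum>i<n. \<tau> (\<iota> (b i)) * x k ^ i)"
    using elem_sym_reindex[OF x, of h "\<lambda>x. \<Sum>i<n. \<tau> (\<iota> (b i)) * x ^ i"] h(2) by simp
  finally have E: "E_map \<iota> \<tau> h \<alpha> = elem_sym h {..<n} (\<lambda>k. \<Sum>i<n. \<tau> (\<iota> (b i)) * x k ^ i)" .

  define \<phi>K where "\<phi>K i = (if i < n then coeff ?f i else b (i - n))" for i
  define z where "z = mpoly_eval \<phi>K (univ_esym n h)"
  have "\<tau> (\<iota> z) = mpoly_eval (\<lambda>i. (\<tau> \<circ> \<iota>) (\<phi>K i)) (univ_esym n h)"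
    unfolding z_def using hom_mpoly_eval[OF \<tau>\<iota>.comm_ring_hom_axioms, of \<phi>K] by simp
  also have "\<dots> = elem_sym h {..<n} (\<lambda>k. \<Sum>i<n. (\<tau> \<circ> \<iota>) (\<phi>K (n + i)) * x k ^ i)"
    by (rule mpoly_eval_univ_esym_roots[OF inj_x _ h(2)]) (use root in \<open>simp add: \<phi>K_def\<close>)
  finally have z: "E_map \<iota> \<tau> h \<alpha> = \<tau> (\<iota> z)" by (simp add: E \<phi>K_def)

  \<comment> \<open>The exponents divide every root by the uniformizer and the element
    \<open>\<alpha>\<close> by its \<open>r\<close>-th power. The value \<open>0\<close> from
    \<open>2 * n\<close> on keeps every argument integral, as \<open>vL_univ_esym_ge\<close>
    requires.\<close>
  define \<phi>L where "\<phi>L i = (if i < n then \<iota> (coeff ?f i) * \<pi> powi (int i - int n)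
    else if i < 2 * n then \<iota> (b (i - n)) * \<pi> powi (int (i - n) - r) else 0)" for i
  define y where "y k = x k / \<tau> \<pi>" for k
  have \<tau>\<pi>: "\<tau> \<pi> \<noteq> 0" using \<pi>_nonzero by simp
  have \<tau>_powi: "\<tau> (\<pi> powi k) = \<tau> \<pi> powi k" for k
    by (simp add: power_int_def \<tau>.hom_power \<tau>.hom_inverse)
  have inj_y: "inj_on y {..<n}"
    using inj_x \<tau>\<pi> by (auto simp: inj_on_def y_def)
  have scale: "\<tau> \<pi> powi (int i - c) * y k ^ i = x k ^ i * \<tau> \<pi> powi (- c)" for c i k
    using \<tau>\<pi> by (simp add: y_def power_divide power_int_diff power_int_minus field_simps)
  have root_y: "y k ^ n + (\<Sum>a<n. \<tau> (\<phi>L a) * y k ^ a) = 0" if "k < n" for k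
  proof -
    have "y k ^ n + (\<Sum>a<n. \<tau> (\<phi>L a) * y k ^ a)
        = (x k ^ n + (\<Sum>a<n. \<tau> (\<iota> (coeff ?f a)) * x k ^ a)) * \<tau> \<pi> powi (- int n)"
    proof -
      have "(\<Sum>a<n. \<tau> (\<phi>L a) * y k ^ a) = (\<Sum>a<n. \<tau> (\<iota> (coeff ?f a)) * x k ^ a * \<tau> \<pi> powi (- int n))"
        by (rule sum.cong) (simp_all add: \<phi>L_def \<tau>.hom_mult \<tau>_powi mult.assoc scale)
      moreover have "y k ^ n = x k ^ n * \<tau> \<pi> powi (- int n)"
        using scale[of n "int n" k] by simp
      ultimately show ?thesis by (simp add: distrib_right sum_distrib_right)
    qed
    with root[OF that] show ?thesis by simp
  qed
  have "\<tau> (mpoly_eval \<phi>L (univ_esym n h)) = elem_sym h {..<n} (\<lambda>k. \<Sum>i<n. \<tau> (\<phi>L (n + i)) * y k ^ i)"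
    unfolding hom_mpoly_eval[OF \<tau>.comm_ring_hom_axioms]
    by (rule mpoly_eval_univ_esym_roots[OF inj_y root_y h(2)])
  also have "\<dots> = elem_sym h {..<n} (\<lambda>k. \<tau> \<pi> powi (- r) * (\<Sum>i<n. \<tau> (\<iota> (b i)) * x k ^ i))"
  proof -
    have "(\<Sum>i<n. \<tau> (\<phi>L (n + i)) * y k ^ i) = \<tau> \<pi> powi (- r) * (\<Sum>i<n. \<tau> (\<iota> (b i)) * x k ^ i)" for k
      unfolding sum_distrib_left
    proof (rule sum.cong[OF refl])
      fix i assume "i \<in> {..<n}"
      then have "\<tau> (\<phi>L (n + i)) * y k ^ i = \<tau> (\<iota> (b i)) * (x k ^ i * \<tau> \<pi> powi (- r))"
        by (simp add: \<phi>L_def \<tau>.hom_mult \<tau>_powi mult.assoc scale)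
      then show "\<tau> (\<phi>L (n + i)) * y k ^ i = \<tau> \<pi> powi (- r) * (\<tau> (\<iota> (b i)) * x k ^ i)"
        by (simp add: mult.left_commute mult.commute)
    qed
    then show ?thesis by simp
  qed
  also have "\<dots> = (\<tau> \<pi> powi (- r)) ^ h * \<tau> (\<iota> z)"
    unfolding elem_sym_scale E[symmetric] z ..
  also have "\<dots> = \<tau> (\<pi> powi (- (r * int h)) * \<iota> z)"
    using power_int_mult[of "\<tau> \<pi>" "- r" "int h"] by (simp add: \<tau>.hom_mult \<tau>_powi)
  finally have "mpoly_eval \<phi>L (univ_esym n h) = \<pi> powi (- (r * int h)) * \<iota> z" by simp
  then have val: "vL (mpoly_eval \<phi>L (univ_esym n h)) = ereal (real n) * vK z - ereal (of_int (r * int h))"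
    by (simp add: L.v_mult L.v_power_int \<pi>_nonzero vL_\<pi> vL_\<iota> minus_ereal_def add.commute)

  have \<phi>L_low: "vL (\<phi>L a) = ereal (real n) * vK (min_poly_coeff \<iota> \<pi> (n - a)) - ereal (real (n - a))"
    if "a < n" for a
  proof -
    have "vK (min_poly_coeff \<iota> \<pi> (n - a)) = vK (coeff ?f a)"
      unfolding min_poly_coeff_def deg[symmetric] using that by (cases "even (n - a)") simp_all
    then show ?thesis
      using that by (simp add: \<phi>L_def L.v_mult L.v_power_int \<pi>_nonzero vL_\<pi> vL_\<iota> minus_ereal_def of_nat_diff)
  qed
  have "0 \<le> vL (\<phi>L i)" for i
  proof -
    consider "i < n" | "n \<le> i" "i < 2 * n" | "2 * n \<le> i" by linarith
    then show ?thesis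
    proof cases
      case 1
      then show ?thesis
        unfolding \<phi>L_low[OF 1] by (intro min_poly_coeff_nonneg[OF deg]) auto
    next
      case 2
      \<comment> \<open>Each term of the expansion of \<open>\<alpha>\<close> has at least the value
        of \<open>\<alpha>\<close>, so its rescaled coefficient is integral.\<close>
      have "ereal (of_int r) \<le> ereal (real n) * vK (b (i - n)) + ereal (real (i - n))"
        using \<alpha> vL_combination_le[of "i - n" b] 2 unfolding b by (auto intro: order_trans)
      then show ?thesis
        using 2 by (cases "vK (b (i - n))")
          (auto simp: \<phi>L_def L.v_mult L.v_power_int \<pi>_nonzero vL_\<pi> vL_\<iota>)
    qed (simp add: \<phi>L_def)
  qed
  then have "insep_index vK vL \<iota> p \<nu> \<pi> j \<le> vL (mpoly_eval \<phi>L (univ_esym n h))"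
    using \<phi>L_low by (intro vL_univ_esym_ge[OF deg p n h j])
  then have "insep_index vK vL \<iota> p \<nu> \<pi> j + ereal (of_int (r * int h)) \<le> ereal (real n) * vK z"
    unfolding val by (simp add: ereal_le_minus)
  with z that show thesis by blast
qed

end

section \<open>From value bounds to powers of the maximal ideal\<close>

theorem theorem4p6:
  fixes vK :: "'k::field \<Rightarrow> ereal" and vL :: "'l::field \<Rightarrow> ereal"
    and \<iota> :: "'k \<Rightarrow> 'l" and \<tau> :: "'l \<Rightarrow> 's::field"
    and p n u \<nu> h j :: nat and r m :: int and \<pi> :: 'l
  assumes "discrete_valuation vK" and "valuation_complete vK"
    and "perfect_field_of_char p (residue_field vK)"
    and "field_hom \<iota>" and "field_hom \<tau>" and "separable_closure (\<tau> \<circ> \<iota>)"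
    and "discrete_valuation vL" and "totally_ramified vK vL \<iota>"
    and "n = ext_degree \<iota>" and "n = u * p ^ \<nu>" and "\<not> p dvd u"
    and "vL \<pi> = 1"
    and "1 \<le> h" and "h \<le> n" and "j = min (multiplicity p h) \<nu>"
    and "m = \<lceil>(real_of_ereal (insep_index vK vL \<iota> p \<nu> \<pi> j) + real h * real_of_int r) / real n\<rceil>"
  shows "E_map \<iota> \<tau> h ` maximal_ideal_power vL r \<subseteq> (\<tau> \<circ> \<iota>) ` maximal_ideal_power vK m
     \<and> ereal (real_of_int m) \<le> g_fun vK vL \<iota> \<tau> h r"
proof -
  have n_pos: "0 < n" using assms(13,14) by simp
  interpret totally_ramified_ext vK vL \<iota> \<pi> n
  proof -
    interpret field_hom \<iota> by fact
    show "totally_ramified_ext vK vL \<iota> \<pi> n"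
      by unfold_locales (use assms n_pos in \<open>simp_all add: totally_ramified_def\<close>)
  qed
  interpret \<tau>: field_hom \<tau> by fact
  have inj: "inj (\<tau> \<circ> \<iota>)" by (auto intro: injI)
  have p: "prime p" using assms(3) by (simp add: perfect_field_of_char_def)
  let ?I = "insep_index vK vL \<iota> p \<nu> \<pi> j"
  have I: "0 \<le> ?I" by (rule insep_index_nonneg) (use assms(9,15) in simp_all)
  have ex: "\<exists>z \<in> maximal_ideal_power vK m. E_map \<iota> \<tau> h \<alpha> = (\<tau> \<circ> \<iota>) z"
    if \<alpha>: "\<alpha> \<in> maximal_ideal_power vL r" for \<alpha>
  proof -
    obtain z where z: "E_map \<iota> \<tau> h \<alpha> = \<tau> (\<iota> z)" "?I + ereal (of_int (r * int h)) \<le> ereal (real n) * vK z"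
      using E_map_descends[OF assms(9,5,6) p assms(10,13,14,15), of r \<alpha>] \<alpha>
      by (auto simp: maximal_ideal_power_def)
    have "ereal (of_int m) \<le> vK z"
    proof (cases "z = 0")
      case False
      then obtain k where k: "vK z = ereal (of_int k)" by (rule K.v_int)
      \<comment> \<open>Nonnegativity excludes \<open>-\<infinity>\<close> for \<open>?I\<close>,
        and the finite right-hand side excludes \<open>\<infinity>\<close>, so
        \<open>real_of_ereal\<close> is faithful here. Since \<open>k\<close> is an integer, the
        ceiling can be taken afterwards.\<close>
      have "real_of_ereal ?I + real_of_int (r * int h) \<le> real n * of_int k"
        using z(2) I unfolding k by (cases ?I) auto
      then have "(real_of_ereal ?I + real h * real_of_int r) / real n \<le> of_int k"
        using n_pos by (simp add: divide_le_eq mult.commute)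
      then have "m \<le> k" unfolding assms(16) by (simp add: ceiling_le_iff)
      then show ?thesis by (simp add: k)
    qed simp
    then show ?thesis using z(1) by (auto simp: maximal_ideal_power_def)
  qed
  moreover have "ereal (of_int m) \<le> g_fun vK vL \<iota> \<tau> h r"
    unfolding g_fun_def
  proof (rule INF_greatest)
    fix \<alpha> assume "\<alpha> \<in> maximal_ideal_power vL r"
    then obtain z where "z \<in> maximal_ideal_power vK m" "E_map \<iota> \<tau> h \<alpha> = (\<tau> \<circ> \<iota>) z" using ex by blast
    then show "ereal (of_int m) \<le> vK (the_inv (\<tau> \<circ> \<iota>) (E_map \<iota> \<tau> h \<alpha>))"
      using the_inv_f_f[OF inj] by (simp add: maximal_ideal_power_def)
  qed
  ultimately show ?thesis by blast
qed

end
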